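(* For integers $1\le m<n$, put $$\tau_{m,n}:=\sqrt{\frac{4\log(n+1)+2}{m+1}}.$$ Then $$c_{m,n}\le\frac{\pi}{2}+\arcsin\bigl(\min\{\tau_{m,n},1\}\bigr).$$ The exact value $c_{m,m+1}=\arccos\bigl(-\tfrac1{m+1}\bigr)$ and monotonicity in the second index give $c_{m,n}\ge c_{m,m+1}$. Consequently, if $(m_j),(n_j)$ are integer sequences with $1\le m_j<n_j$, $m_j\to\infty$, and $\log(n_j+1)=o(m_j)$, then $$c_{m_j,n_j}\longrightarrow\frac{\pi}{2}.$$ In particular, the conclusion holds if $n_j/m_j\to\lambda$ for some $1<\lambda<\infty$.
   Context: For $m\ge1$, $\mathbb S^m\subset\mathbb R^{m+1}$ is the unit round sphere with geodesic metric $\arccos\langle x,x'\rangle$; $\mathbb S^0$ is two points at distance $\pi$. The group $C_2$ of order two acts antipodally on each sphere; a map between $C_2$-spaces is odd if it is $C_2$-equivariant. The coindex of a $C_2$-space $X$ is $\mathrm{coind}(X):=\sup\{k\ge0:\text{there is a continuous odd map }\mathbb S^k\to X\}$. For a metric space $X$ and $r\ge0$, $\mathrm{VR}(X;r)$ is the geometric realization of the simplicial complex with vertex set $X$ whose simplices are the nonempty finite subsets of diameter at most $r$; $\mathrm{VR}(\mathbb S^m;r)$ carries the $C_2$-action induced by the antipodal map. For integers $0\le m\le n$, $$c_{m,n}:=\inf\{r\ge0:\mathrm{coind}(\mathrm{VR}(\mathbb S^m;r))\ge n\}.$$ The value $c_{m,m+1}=\arccos(-1/(m+1))$ is a known result from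 earlier work. *)

theory Defs
  imports "HOL-Analysis.Analysis" "HOL-Library.Landau_Symbols" "HOL-Library.Extended_Nat"
begin

section \<open>Geometric realization of a simplicial complex\<close>

text \<open>
  A simplicial complex is given by its set of simplices (nonempty finite sets of vertices).
  A point of its realization is recorded by its barycentric coordinates, a function on the
  vertices that vanishes off some simplex.
\<close>

definition closed_simplex :: "'a set \<Rightarrow> ('a \<Rightarrow> real) set" where
  "closed_simplex s = {p. (\<forall>v. 0 \<le> p v) \<and> (\<forall>v. v \<notin> s \<longrightarrow> p v = 0) \<and> (\<Sum>v\<in>s. p v) = 1}"

text \<open>
  The topology is the weak (coherent) one: a set is open iff its trace on every closed simplex
  is open. On a closed simplex, which has finitely many vertices, the product topology is the
  Euclidean one.
\<close>

definition geometric_realization :: "'a set set \<Rightarrow> ('a \<Rightarrow> real) topology" where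
  "geometric_realization K = topology (\<lambda>U.
     U \<subseteq> (\<Union>s\<in>K. closed_simplex s) \<and>
     (\<forall>s\<in>K. openin (subtopology (powertop_real UNIV) (closed_simplex s)) (U \<inter> closed_simplex s)))"

lemma openin_geometric_realization:
  "openin (geometric_realization K) U \<longleftrightarrow>
     U \<subseteq> (\<Union>s\<in>K. closed_simplex s) \<and>
     (\<forall>s\<in>K. openin (subtopology (powertop_real UNIV) (closed_simplex s)) (U \<inter> closed_simplex s))"
proof -
  have "istopology (\<lambda>U. U \<subseteq> (\<Union>s\<in>K. closed_simplex s) \<and>
     (\<forall>s\<in>K. openin (subtopology (powertop_real UNIV) (closed_simplex s)) (U \<inter> closed_simplex s)))"
    (is "istopology ?P")
    unfolding istopology_def
  proof (intro conjI allI impI)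
    fix S T assume S: "?P S" and T: "?P T"
    show "S \<inter> T \<subseteq> (\<Union>s\<in>K. closed_simplex s)"
      using S by blast
    show "\<forall>s\<in>K. openin (subtopology (powertop_real UNIV) (closed_simplex s))
                  (S \<inter> T \<inter> closed_simplex s)"
    proof
      fix s assume "s \<in> K"
      moreover have "S \<inter> T \<inter> closed_simplex s = (S \<inter> closed_simplex s) \<inter> (T \<inter> closed_simplex s)"
        by blast
      ultimately show "openin (subtopology (powertop_real UNIV) (closed_simplex s))
                         (S \<inter> T \<inter> closed_simplex s)"
        using S T by (metis openin_Int)
    qed
  next
    fix \<K> assume \<K>: "\<forall>S\<in>\<K>. ?P S"
    show "\<Union>\<K> \<subseteq> (\<Union>s\<in>K. closed_simplex s)"
      using \<K> by blast
    show "\<forall>s\<in>K. openin (subtopology (powertop_real UNIV) (closed_simplex s))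
                  (\<Union>\<K> \<inter> closed_simplex s)"
    proof
      fix s assume "s \<in> K"
      moreover have "\<Union>\<K> \<inter> closed_simplex s = \<Union>((\<lambda>S. S \<inter> closed_simplex s) ` \<K>)"
        by blast
      moreover have "openin (subtopology (powertop_real UNIV) (closed_simplex s))
                       (\<Union>((\<lambda>S. S \<inter> closed_simplex s) ` \<K>))"
        using \<K> \<open>s \<in> K\<close> by (intro openin_Union) blast
      ultimately show "openin (subtopology (powertop_real UNIV) (closed_simplex s))
                         (\<Union>\<K> \<inter> closed_simplex s)"
        by simp
    qed
  qed
  then show ?thesis
    by (simp add: geometric_realization_def topology_inverse')
qed

lemma topspace_geometric_realization:
  "topspace (geometric_realization K) = (\<Union>s\<in>K. closed_simplex s)"
proof
  show "topspace (geometric_realization K) \<subseteq> (\<Union>s\<in>K. closed_simplex s)"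
    using openin_geometric_realization[of K "topspace (geometric_realization K)"] by simp
  have "openin (subtopology (powertop_real UNIV) (closed_simplex s))
          ((\<Union>t\<in>K. closed_simplex t) \<inter> closed_simplex s)" if "s \<in> K" for s
  proof -
    have "(\<Union>t\<in>K. closed_simplex t) \<inter> closed_simplex s = closed_simplex s"
      using that by blast
    moreover have "topspace (subtopology (powertop_real UNIV) (closed_simplex s)) = closed_simplex s"
      by simp
    ultimately show ?thesis
      by (metis openin_topspace)
  qed
  then have "openin (geometric_realization K) (\<Union>s\<in>K. closed_simplex s)"
    by (simp add: openin_geometric_realization)
  then show "(\<Union>s\<in>K. closed_simplex s) \<subseteq> topspace (geometric_realization K)"
    by (rule openin_subset)
qed

text \<open>The map on realizations that extends a map of vertices affinely over each simplex.\<close>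

definition realization_map :: "('a \<Rightarrow> 'b) \<Rightarrow> ('a \<Rightarrow> real) \<Rightarrow> ('b \<Rightarrow> real)" where
  "realization_map \<phi> p = (\<lambda>w. \<Sum>v | p v \<noteq> 0 \<and> \<phi> v = w. p v)"


section \<open>Vietoris--Rips complexes\<close>

text \<open>The library's constant for the diameter is tied to the metric of a type class;
  here the metric space is a set with a distance function.\<close>

definition diam :: "('a \<Rightarrow> 'a \<Rightarrow> real) \<Rightarrow> 'a set \<Rightarrow> real" where
  "diam d s = (SUP (x,y)\<in>s\<times>s. d x y)"

lemma diam_le_iff:
  assumes "finite s" "s \<noteq> {}"
  shows "diam d s \<le> r \<longleftrightarrow> (\<forall>x\<in>s. \<forall>y\<in>s. d x y \<le> r)"
proof -
  have "diam d s \<le> r \<longleftrightarrow> (\<forall>z\<in>s\<times>s. (case z of (x,y) \<Rightarrow> d x y) \<le> r)"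
    unfolding diam_def using assms by (intro cSUP_le_iff) auto
  then show ?thesis
    by auto
qed

definition VR_simplices :: "'a set \<Rightarrow> ('a \<Rightarrow> 'a \<Rightarrow> real) \<Rightarrow> real \<Rightarrow> 'a set set" where
  "VR_simplices X d r = {s. finite s \<and> s \<noteq> {} \<and> s \<subseteq> X \<and> diam d s \<le> r}"

definition VR :: "'a set \<Rightarrow> ('a \<Rightarrow> 'a \<Rightarrow> real) \<Rightarrow> real \<Rightarrow> ('a \<Rightarrow> real) topology" where
  "VR X d r = geometric_realization (VR_simplices X d r)"


section \<open>Spheres, coindex, and the constants\<close>

text \<open>
  The unit sphere of dimension \<open>m\<close> is \<open>nsphere m\<close>; its points are functions on the naturals
  that vanish at all indices above \<open>m\<close>.
\<close>

definition geodesic_dist :: "nat \<Rightarrow> (nat \<Rightarrow> real) \<Rightarrow> (nat \<Rightarrow> real) \<Rightarrow> real" where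
  "geodesic_dist m x y = arccos (\<Sum>i\<le>m. x i * y i)"

definition antipode :: "(nat \<Rightarrow> real) \<Rightarrow> (nat \<Rightarrow> real)" where
  "antipode x = (\<lambda>i. - x i)"

text \<open>A space with an action of the group of order two is a topology \<open>T\<close> together with the
  involution \<open>\<nu>\<close> by which the generator acts.\<close>

definition odd_map :: "'a topology \<Rightarrow> ('a \<Rightarrow> 'a) \<Rightarrow> 'b topology \<Rightarrow> ('b \<Rightarrow> 'b) \<Rightarrow> ('a \<Rightarrow> 'b) \<Rightarrow> bool" where
  "odd_map S \<mu> T \<nu> f \<longleftrightarrow> (\<forall>x\<in>topspace S. f (\<mu> x) = \<nu> (f x))"

definition coind :: "'a topology \<Rightarrow> ('a \<Rightarrow> 'a) \<Rightarrow> enat" where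
  "coind T \<nu> = Sup {enat k | k. \<exists>f. continuous_map (nsphere k) T f \<and> odd_map (nsphere k) antipode T \<nu> f}"

definition VR_sphere :: "nat \<Rightarrow> real \<Rightarrow> ((nat \<Rightarrow> real) \<Rightarrow> real) topology" where
  "VR_sphere m r = VR (topspace (nsphere m)) (geodesic_dist m) r"

definition coind_threshold :: "nat \<Rightarrow> nat \<Rightarrow> real" where
  "coind_threshold m n = Inf {r. 0 \<le> r \<and> coind (VR_sphere m r) (realization_map antipode) \<ge> enat n}"

definition tau :: "nat \<Rightarrow> nat \<Rightarrow> real" where
  "tau m n = sqrt ((4 * ln (real n + 1) + 2) / (real m + 1))"

end

theory Submission
  imports Defs "HOL-Homology.Invariance_of_Domain"
begin

text \<open>
  The thresholds are bounded above by explicit odd maps and below by the Borsuk-Ulam theorem.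

  An odd map from a sphere into the Vietoris-Rips complex is given by nonnegative weights on
  finitely many antipodal pairs of vertices such that vertices with positive weight at the same
  point are pairwise within the scale (\<open>coind_VR_sphere_ge\<close>). For \<open>n + 1\<close> unit vectors with
  pairwise inner products at most \<open>\<tau>\<close> in absolute value, the boundary of the cross-polytope on
  these vectors and their antipodes maps to the complex at scale \<open>\<pi> / 2 + arcsin \<tau>\<close>. A
  greedy choice of sign vectors, controlled by a Chernoff bound, finds such vectors for
  \<open>\<tau> = tau m n\<close> (\<open>almost_orthogonal_vectors\<close>). At scale \<open>arccos (- 1 / (m + 1))\<close> the complex
  contains an inscribed regular simplex; coning off a fine equator over it, and over its antipode,
  gives an odd map from the sphere of dimension \<open>m + 1\<close> (\<open>coind_VR_sphere_simplex\<close>).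

  Conversely, below that scale no simplex of the complex has the origin in its convex hull
  (\<open>barycenter_nonzero\<close>), so radially projected barycenters form an odd map from the complex to
  the sphere of dimension \<open>m\<close>, and an odd map from the sphere of dimension \<open>m + 1\<close> into the
  complex would violate \<open>Borsuk_Ulam\<close>. This gives the exact value for \<open>n = m + 1\<close>,
  and a lower bound for larger \<open>n\<close> by monotonicity.

  The Borsuk-Ulam theorem follows from Borsuk's theorem that odd self-maps of spheres have odd
  degree (\<open>odd_Brouwer_degree\<close>). For maps that preserve the equator the degree is the same modulo
  2 as that of the restriction to the equator; the remaining work is to deform an odd map to one
  that preserves the equator (\<open>odd_map_deform_to_equator\<close>), by interpolation on a centrally
  symmetric triangulation and a general position argument.

  Both bounds tend to \<open>\<pi> / 2\<close> when \<open>m\<close> tends to infinity and \<open>ln (n + 1)\<close> is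
  negligible compared with \<open>m\<close>.
\<close>

section \<open>Coordinates on spheres\<close>

definition dot :: "nat \<Rightarrow> (nat \<Rightarrow> real) \<Rightarrow> (nat \<Rightarrow> real) \<Rightarrow> real" where
  "dot k x y = (\<Sum>i\<le>k. x i * y i)"

abbreviation Sph :: "nat \<Rightarrow> (nat \<Rightarrow> real) set" where
  "Sph k \<equiv> topspace (nsphere k)"

lemma Sph_iff: "x \<in> Sph k \<longleftrightarrow> dot k x x = 1 \<and> (\<forall>i>k. x i = 0)"
  by (auto simp: nsphere dot_def power2_eq_square)

text \<open>
  The product topology on sequences is the topology of their type, so that continuity of maps
  between spheres can be handled with the calculus of \<open>continuous_on\<close>.
\<close>

lemma nsphere_eq_top_of_set: "nsphere k = top_of_set (Sph k)"
  by (simp add: nsphere euclidean_product_topology)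

lemma continuous_map_nsphere_iff:
  "continuous_map (nsphere k) (nsphere l) f \<longleftrightarrow> continuous_on (Sph k) f \<and> f \<in> Sph k \<rightarrow> Sph l"
  using continuous_map_subtopology_eu[of "Sph k" "Sph l" f]
  by (simp add: image_subset_iff_funcset flip: nsphere_eq_top_of_set)

lemma dot_commute: "dot k x y = dot k y x"
  by (simp add: dot_def mult.commute)

lemma dot_self_nonneg: "0 \<le> dot k x x"
  by (simp add: dot_def sum_nonneg)

lemma dot_self_eq_0: "dot k x x = 0 \<longleftrightarrow> (\<forall>i\<le>k. x i = 0)"
  by (auto simp: dot_def sum_nonneg_eq_0_iff)

lemma dot_minus: "dot k (\<lambda>i. - x i) y = - dot k x y" "dot k x (\<lambda>i. - y i) = - dot k x y"
  by (simp_all add: dot_def sum_negf)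

lemma dot_scale: "dot k (\<lambda>i. c * x i) y = c * dot k x y" "dot k x (\<lambda>i. c * y i) = c * dot k x y"
  by (simp_all add: dot_def sum_distrib_left mult_ac)

lemma dot_add: "dot k (\<lambda>i. x i + y i) z = dot k x z + dot k y z" 
  "dot k z (\<lambda>i. x i + y i) = dot k z x + dot k z y"
  by (simp_all add: dot_def sum.distrib algebra_simps)

lemma dot_diff: "dot k (\<lambda>i. x i - y i) z = dot k x z - dot k y z" 
  "dot k z (\<lambda>i. x i - y i) = dot k z x - dot k z y"
  by (simp_all add: dot_def sum_subtractf algebra_simps)

lemma dot_sum: "dot k (\<lambda>i. \<Sum>v\<in>A. f v i) y = (\<Sum>v\<in>A. dot k (f v) y)"
  "dot k y (\<lambda>i. \<Sum>v\<in>A. f v i) = (\<Sum>v\<in>A. dot k y (f v))"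
  by (simp_all add: dot_def sum_distrib_left sum_distrib_right sum.swap[of _ A])

lemma dot_Cauchy_Schwarz: "(dot k x y)\<^sup>2 \<le> dot k x x * dot k y y"
  unfolding dot_def using Cauchy_Schwarz_ineq_sum[of x y "{..k}"] by (simp add: power2_eq_square)

lemma abs_dot_le_1:
  assumes "x \<in> Sph k" "y \<in> Sph k"
  shows "\<bar>dot k x y\<bar> \<le> 1"
  using dot_Cauchy_Schwarz[of k x y] assms by (simp add: Sph_iff abs_square_le_1)

lemma dot_diff_self:
  assumes "x \<in> Sph k" "y \<in> Sph k"
  shows "dot k (\<lambda>i. x i - y i) (\<lambda>i. x i - y i) = 2 - 2 * dot k x y"
  using assms by (simp add: dot_diff Sph_iff dot_commute[of k y x])

lemma Sph_eqI:
  assumes "x \<in> Sph k" "y \<in> Sph k" "\<And>i. i \<le> k \<Longrightarrow> x i = y i"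
  shows "x = y"
  using assms unfolding Sph_iff by (metis ext not_le)

lemma minus_in_Sph: "(\<lambda>i. - x i) \<in> Sph k \<longleftrightarrow> x \<in> Sph k"
  by (simp add: Sph_iff dot_minus)

lemma antipode_in_Sph: "antipode x \<in> Sph k \<longleftrightarrow> x \<in> Sph k"
  by (simp add: antipode_def minus_in_Sph)

lemma Sph_mono: assumes "k \<le> l" shows "Sph k \<subseteq> Sph l"
proof
  fix x assume x: "x \<in> Sph k"
  then have "dot l x x = dot k x x"
    unfolding dot_def using assms by (intro sum.mono_neutral_right) (auto simp: Sph_iff)
  with x assms show "x \<in> Sph l" by (auto simp: Sph_iff)
qed

lemma abs_coordinate_le_1: assumes "x \<in> Sph k" shows "\<bar>x i\<bar> \<le> 1"
proof (cases "i \<le> k")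
  case True
  have "x i * x i \<le> dot k x x"
    unfolding dot_def using True by (intro member_le_sum) auto
  then show ?thesis using assms by (simp add: Sph_iff flip: abs_square_le_1 power2_eq_square)
qed (use assms in \<open>auto simp: Sph_iff\<close>)

lemma continuous_on_coord:
  "continuous_on A f \<Longrightarrow> continuous_on A (\<lambda>x. f x i)" for f :: "'a::topological_space \<Rightarrow> nat \<Rightarrow> real"
  by (rule continuous_on_product_then_coordinatewise)

lemma continuous_on_coordinate: "continuous_on A (\<lambda>x :: nat \<Rightarrow> real. x i)"
  by (rule continuous_on_subset[OF continuous_on_product_coordinates]) simp

lemma continuous_on_dot:
  "continuous_on A f \<Longrightarrow> continuous_on A g \<Longrightarrow> continuous_on A (\<lambda>x. dot k (f x) (g x))"
  for f :: "'a::topological_space \<Rightarrow> nat \<Rightarrow> real"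
  unfolding dot_def by (intro continuous_on_sum continuous_on_mult) (rule continuous_on_coord, assumption)+

lemma compact_Sph: "compact (Sph k)"
proof -
  have "compactin (powertop_real UNIV) (PiE UNIV (\<lambda>i. {-1..1::real}))"
    by (subst compactin_PiE) (simp add: compactin_euclidean_iff)
  then have c: "compact (PiE UNIV (\<lambda>i::nat. {-1..1::real}))"
    by (simp add: euclidean_product_topology)
  have "Sph k = {x. dot k x x = 1} \<inter> (\<Inter>i\<in>{k<..}. {x. x i = 0})"
    by (auto simp: Sph_iff)
  moreover have "closed {x::nat\<Rightarrow>real. dot k x x = 1}"
    by (intro closed_Collect_eq continuous_on_dot continuous_on_id continuous_on_const)
  moreover have "closed (\<Inter>i\<in>{k<..}. {x::nat\<Rightarrow>real. x i = 0})"
    by (intro closed_INT ballI closed_Collect_eq continuous_on_const continuous_on_product_coordinates)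
  ultimately have "closed (Sph k)" by auto
  moreover have "Sph k \<subseteq> PiE UNIV (\<lambda>i. {-1..1})"
    using abs_coordinate_le_1 by (auto simp: abs_le_iff minus_le_iff)
  ultimately show ?thesis using c by (metis compact_Int_closed inf.absorb_iff2)
qed

text \<open>
  Radial projection; its value at the origin is the zero vector, which is off the sphere.
\<close>

definition to_sphere :: "nat \<Rightarrow> (nat \<Rightarrow> real) \<Rightarrow> nat \<Rightarrow> real" where
  "to_sphere k y = (\<lambda>i. if i \<le> k then y i / sqrt (dot k y y) else 0)"

lemma to_sphere_in_Sph: assumes "dot k y y \<noteq> 0" shows "to_sphere k y \<in> Sph k"
proof -
  have "dot k (to_sphere k y) (to_sphere k y) = (\<Sum>i\<le>k. y i * y i / dot k y y)"
    unfolding dot_def[of k "to_sphere k y"]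
    by (rule sum.cong) (use dot_self_nonneg[of k y] in \<open>auto simp: to_sphere_def\<close>)
  also have "\<dots> = 1" using assms by (simp add: dot_def flip: sum_divide_distrib)
  finally show ?thesis by (simp add: Sph_iff to_sphere_def)
qed

lemma to_sphere_Sph: assumes "x \<in> Sph k" shows "to_sphere k x = x"
  using assms by (auto simp: to_sphere_def Sph_iff)

lemma to_sphere_cong: "(\<And>i. i \<le> k \<Longrightarrow> x i = y i) \<Longrightarrow> to_sphere k x = to_sphere k y"
  by (auto simp: to_sphere_def dot_def intro!: ext)

lemma to_sphere_minus: "to_sphere k (\<lambda>i. - y i) = (\<lambda>i. - to_sphere k y i)"
  by (auto simp: to_sphere_def dot_minus)

lemma to_sphere_scale: assumes "c > 0" shows "to_sphere k (\<lambda>i. c * y i) = to_sphere k y"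
proof -
  have "sqrt (dot k (\<lambda>i. c * y i) (\<lambda>i. c * y i)) = c * sqrt (dot k y y)"
    using assms by (simp add: dot_scale real_sqrt_mult)
  then show ?thesis using assms by (auto simp: to_sphere_def)
qed

lemma continuous_on_to_sphere:
  assumes "continuous_on A f" "\<And>x. x \<in> A \<Longrightarrow> dot k (f x) (f x) \<noteq> 0"
  shows "continuous_on A (\<lambda>x. to_sphere k (f x))"
proof (rule continuous_on_coordinatewise_then_product)
  fix i show "continuous_on A (\<lambda>x. to_sphere k (f x) i)"
    unfolding to_sphere_def using assms 
    by (cases "i \<le> k")
      (auto intro!: continuous_on_divide continuous_on_const continuous_on_real_sqrt continuous_on_dot continuous_on_coord[OF assms(1)])
qed

text \<open>
  All homotopies below are first written down in the ambient vector space, where it only has to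
  be checked that they avoid the origin.
\<close>

lemma homotopic_to_sphere:
  fixes H :: "real \<times> (nat \<Rightarrow> real) \<Rightarrow> nat \<Rightarrow> real"
  assumes "continuous_on ({0..1} \<times> Sph k) H"
    and "\<And>s x. \<lbrakk>0 \<le> s; s \<le> 1; x \<in> Sph k\<rbrakk> \<Longrightarrow> dot l (H (s,x)) (H (s,x)) \<noteq> 0"
  shows "homotopic_with (\<lambda>_. True) (nsphere k) (nsphere l)
    (\<lambda>x. to_sphere l (H (0,x))) (\<lambda>x. to_sphere l (H (1,x)))"
  unfolding homotopic_with_def
proof (intro exI conjI allI ballI)
  have "continuous_on ({0..1::real} \<times> Sph k) (\<lambda>z. to_sphere l (H z))"
    using assms by (intro continuous_on_to_sphere) auto
  moreover have "(\<lambda>z. to_sphere l (H z)) \<in> {0..1::real} \<times> Sph k \<rightarrow> Sph l"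
    using assms(2) by (auto intro!: to_sphere_in_Sph)
  ultimately show "continuous_map (prod_topology (top_of_set {0..1}) (nsphere k)) (nsphere l) (\<lambda>z. to_sphere l (H z))"
    using continuous_map_subtopology_eu[of "{0..1} \<times> Sph k" "Sph l" "\<lambda>z. to_sphere l (H z)"]
    by (simp add: image_subset_iff_funcset flip: nsphere_eq_top_of_set prod_topology_subtopology_eu)
qed auto

section \<open>Lines in general position\<close>

lemma dot_Suc: "dot (Suc k) x y = dot k x y + x (Suc k) * y (Suc k)"
  by (simp add: dot_def)

text \<open>
  Fewer linear equations than unknowns, by Gaussian elimination on the last unknown. The dimension
  varies inside the later inductions, so it cannot be encoded in a type.
\<close>

lemma common_annihilator:
  assumes "finite S" "card S \<le> k"
  shows "\<exists>a. (\<exists>i\<le>k. a i \<noteq> 0) \<and> (\<forall>y\<in>S. dot k a y = 0)"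
  using assms
proof (induction k arbitrary: S)
  case 0
  then show ?case by (intro exI[of _ "\<lambda>_. 1"]) auto
next
  case (Suc k)
  show ?case
  proof (cases "\<forall>y\<in>S. y (Suc k) = 0")
    case True
    have "dot (Suc k) (\<lambda>i. if i = Suc k then 1 else 0) y = y (Suc k)" for y
      by (simp add: dot_def if_distrib[where f = "\<lambda>x. x * _"] cong: if_cong)
    then show ?thesis
      using True by (intro exI[of _ "\<lambda>i. if i = Suc k then 1 else 0"]) auto
  next
    case False
    then obtain y0 where y0: "y0 \<in> S" "y0 (Suc k) \<noteq> 0" by blast
    define r where "r = (\<lambda>y i. y i - y (Suc k) / y0 (Suc k) * y0 i)"
    have "card (r ` (S - {y0})) \<le> card (S - {y0})"
      using Suc.prems by (intro card_image_le) auto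
    also have "\<dots> \<le> k" using Suc.prems y0 by simp
    finally obtain a where a: "\<exists>i\<le>k. a i \<noteq> 0" "\<And>y. y \<in> S - {y0} \<Longrightarrow> dot k a (r y) = 0"
      using Suc.IH[of "r ` (S - {y0})"] Suc.prems by auto
    define b where "b = a(Suc k := - dot k a y0 / y0 (Suc k))"
    have bk: "dot k b y = dot k a y" for y
      unfolding dot_def b_def by (rule sum.cong) auto
    have b0: "dot (Suc k) b y0 = 0"
      using y0 by (simp add: dot_Suc bk) (simp add: b_def)
    have "dot (Suc k) b y = 0" if "y \<in> S" for y
    proof (cases "y = y0")
      case False
      have "dot (Suc k) b (r y) = 0"
        using a(2)[of y] False that y0 by (simp add: dot_Suc bk) (simp add: r_def)
      moreover have "dot (Suc k) b (r y) = dot (Suc k) b y - y (Suc k) / y0 (Suc k) * dot (Suc k) b y0"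
        unfolding r_def by (simp only: dot_diff dot_scale)
      ultimately show ?thesis using b0 by simp
    qed (use b0 in simp)
    moreover have "\<exists>i\<le>Suc k. b i \<noteq> 0"
    proof -
      obtain i where "i \<le> k" "a i \<noteq> 0" using a(1) by blast
      then show ?thesis by (intro exI[of _ i]) (simp add: b_def)
    qed
    ultimately show ?thesis by blast
  qed
qed

text \<open>
  On the moment curve each nonzero linear form restricts to a nonzero polynomial in one variable,
  so finitely many of them have only finitely many zeros there. The curve is parametrized so that
  the last coordinate is 1.
\<close>

lemma avoid_hyperplanes:
  assumes "finite A" "\<And>a. a \<in> A \<Longrightarrow> \<exists>i\<le>k. a i \<noteq> 0"
  shows "\<exists>p. p k = 1 \<and> (\<forall>a\<in>A. dot k a p \<noteq> 0)"
proof -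
  define Z where "Z a = {t::real. (\<Sum>j\<le>k. a (k - j) * t ^ j) = 0}" for a :: "nat \<Rightarrow> real"
  have "finite (Z a)" if a: "a \<in> A" for a
  proof -
    obtain i where "i \<le> k" "a i \<noteq> 0" using assms(2)[OF a] by blast
    then have "\<exists>j\<le>k. a (k - j) \<noteq> 0" by (intro exI[of _ "k - i"]) auto
    then show ?thesis unfolding Z_def
      by (subst polyfun_finite_roots[of "\<lambda>j. a (k - j)"])
  qed
  then have "finite (\<Union>a\<in>A. Z a)" using assms(1) by blast
  then obtain t where t: "t \<notin> (\<Union>a\<in>A. Z a)"
    using ex_new_if_finite infinite_UNIV_char_0 by blast
  have "dot k a (\<lambda>i. t ^ (k - i)) = (\<Sum>j\<le>k. a (k - j) * t ^ j)" for a
    unfolding dot_def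
    by (rule sum.reindex_bij_witness[of _ "\<lambda>j. k - j" "\<lambda>i. k - i"]) auto
  then show ?thesis
    using t by (intro exI[of _ "\<lambda>i. t ^ (k - i)"]) (auto simp: Z_def)
qed

text \<open>
  Dimension count behind general position: the span of \<open>k\<close> vectors in a space of dimension
  \<open>k + 1\<close> is proper, so some line meets none of the spans of \<open>k\<close> vectors from a
  given finite set except at the origin.
\<close>

lemma avoid_small_spans:
  fixes G :: "(nat \<Rightarrow> real) set"
  assumes "finite G"
  obtains p where "p k = 1"
    and "\<And>S w c. \<lbrakk>S \<subseteq> G; card S \<le> k; \<And>i. i \<le> k \<Longrightarrow> (\<Sum>v\<in>S. w v * v i) = c * p i\<rbrakk> \<Longrightarrow> c = 0"
proof -
  have "\<exists>a. (\<exists>i\<le>k. a i \<noteq> 0) \<and> (\<forall>y\<in>S. dot k a y = 0)" if "S \<subseteq> G" "card S \<le> k" for S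
    using common_annihilator[of S k] that assms finite_subset by blast
  then obtain ann where ann: "\<And>S. \<lbrakk>S \<subseteq> G; card S \<le> k\<rbrakk> \<Longrightarrow> (\<exists>i\<le>k. ann S i \<noteq> 0) \<and> (\<forall>y\<in>S. dot k (ann S) y = 0)"
    by metis
  let ?F = "{S. S \<subseteq> G \<and> card S \<le> k}"
  have fin: "finite (ann ` ?F)" using assms by simp
  have nz: "\<exists>i\<le>k. a i \<noteq> 0" if "a \<in> ann ` ?F" for a
    using that ann by force
  from avoid_hyperplanes[OF fin nz]
  obtain p where p: "p k = 1" and "\<forall>a \<in> ann ` ?F. dot k a p \<noteq> 0"
    by blast
  then have p2: "dot k (ann S) p \<noteq> 0" if "S \<subseteq> G" "card S \<le> k" for S
    using that by blast
  show thesis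
  proof
    fix S w and c :: real
    assume S: "S \<subseteq> G" "card S \<le> k" and eq: "\<And>i. i \<le> k \<Longrightarrow> (\<Sum>v\<in>S. w v * v i) = c * p i"
    have "c * dot k (ann S) p = dot k (ann S) (\<lambda>i. c * p i)"
      by (simp only: dot_scale)
    also have "\<dots> = dot k (ann S) (\<lambda>i. \<Sum>v\<in>S. w v * v i)"
      unfolding dot_def by (rule sum.cong) (auto simp: eq)
    also have "\<dots> = (\<Sum>v\<in>S. w v * dot k (ann S) v)"
      by (simp only: dot_sum dot_scale)
    also have "\<dots> = 0" using ann[OF S] by simp
    finally show "c = 0" using p2[OF S] by simp
  qed (rule p)
qed

section \<open>A symmetric triangulation of the sphere\<close>

text \<open>
  The maximum norm on the first \<open>k + 1\<close> coordinates, by recursion so that its continuity is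
  an immediate induction.
\<close>

primrec sup_norm :: "nat \<Rightarrow> (nat \<Rightarrow> real) \<Rightarrow> real" where
  "sup_norm 0 x = \<bar>x 0\<bar>"
| "sup_norm (Suc k) x = max (sup_norm k x) \<bar>x (Suc k)\<bar>"

lemma abs_le_sup_norm: "i \<le> k \<Longrightarrow> \<bar>x i\<bar> \<le> sup_norm k x"
  by (induction k) (auto simp: le_Suc_eq)

lemma sup_norm_attained: "\<exists>i\<le>k. sup_norm k x = \<bar>x i\<bar>"
proof (induction k)
  case (Suc k)
  then obtain i where "i \<le> k" "sup_norm k x = \<bar>x i\<bar>" by blast
  then show ?case
    by (cases "sup_norm k x \<le> \<bar>x (Suc k)\<bar>") (auto intro: exI[of _ i] exI[of _ "Suc k"])
qed auto

lemma sup_norm_minus: "sup_norm k (\<lambda>i. - x i) = sup_norm k x"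
  by (induction k) auto

lemma continuous_on_sup_norm: "continuous_on A (sup_norm k)"
proof (induction k)
  case 0
  show ?case unfolding sup_norm.simps
    by (intro continuous_on_rabs continuous_on_coordinate)
next
  case (Suc k)
  then show ?case unfolding sup_norm.simps
    by (intro continuous_on_max continuous_on_rabs continuous_on_coordinate)
qed

lemma sup_norm_pos: assumes "x \<in> Sph k" shows "0 < sup_norm k x"
proof -
  have "\<exists>i\<le>k. x i \<noteq> 0" using assms dot_self_eq_0[of k x] by (auto simp: Sph_iff)
  then show ?thesis using abs_le_sup_norm[of _ k x] by force
qed

lemma sup_norm_le_1: "x \<in> Sph k \<Longrightarrow> sup_norm k x \<le> 1"
  using sup_norm_attained[of k x] abs_coordinate_le_1 by metis

text \<open>
  The radial homeomorphism from the sphere to the boundary of the cube of side \<open>2 N\<close>. The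
  point of using the cube is that one coordinate of the image is always an integer.
\<close>

definition stretch :: "nat \<Rightarrow> nat \<Rightarrow> (nat \<Rightarrow> real) \<Rightarrow> nat \<Rightarrow> real" where
  "stretch k N x = (\<lambda>i. (real N / sup_norm k x) * x i)"

text \<open>
  A bump function at the lattice point \<open>v\<close>. It is positive exactly on the open star of \<open>v\<close>
  in the Freudenthal (Kuhn) triangulation: the differences \<open>u i - v i\<close>, together with 0, lie in
  an interval of length less than 1. The index \<open>Suc k\<close>, where both \<open>u\<close> and \<open>v\<close>
  vanish, supplies that 0. The triangulation is centrally symmetric, and so is the family of
  bumps. Radial projection of weighted sums takes
  the place of a partition of unity.
\<close>

definition hat :: "nat \<Rightarrow> nat \<Rightarrow> (nat \<Rightarrow> int) \<Rightarrow> (nat \<Rightarrow> real) \<Rightarrow> real" where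
  "hat k N v x = (\<Prod>i\<le>Suc k. \<Prod>j\<le>Suc k.
     max 0 (1 - ((stretch k N x i - v i) - (stretch k N x j - v j))))"

definition lattice_pts :: "nat \<Rightarrow> nat \<Rightarrow> (nat \<Rightarrow> int) set" where
  "lattice_pts k N = {v. (\<forall>i\<le>k. \<bar>v i\<bar> \<le> int N) \<and> (\<forall>i>k. v i = 0) \<and> (\<exists>i\<le>k. v i \<noteq> 0)}"

lemma finite_lattice_pts: "finite (lattice_pts k N)"
proof (rule finite_subset)
  show "lattice_pts k N \<subseteq> {f. \<forall>x. (x \<in> {..k} \<longrightarrow> f x \<in> {- int N..int N}) \<and> (x \<notin> {..k} \<longrightarrow> f x = 0)}"
    by (auto simp: lattice_pts_def abs_le_iff)
  show "finite {f. \<forall>x. (x \<in> {..k} \<longrightarrow> f x \<in> {- int N..int N}) \<and> (x \<notin> {..k} \<longrightarrow> f x = 0)}"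
    by (intro finite_set_of_finite_funs) auto
qed

lemma minus_lattice_pts: "(\<lambda>i. - v i) \<in> lattice_pts k N \<longleftrightarrow> v \<in> lattice_pts k N"
  by (auto simp: lattice_pts_def)

lemma stretch_minus: "stretch k N (\<lambda>i. - x i) = (\<lambda>i. - stretch k N x i)"
  by (simp add: stretch_def sup_norm_minus)

lemma hat_nonneg: "0 \<le> hat k N v x"
  unfolding hat_def by (intro prod_nonneg ballI max.cobounded1)

lemma hat_minus: "hat k N (\<lambda>i. - v i) (\<lambda>i. - x i) = hat k N v x"
  unfolding hat_def stretch_minus
  by (subst prod.swap) (simp add: algebra_simps del: prod.atMost_Suc)

lemma hat_nonzero_iff:
  "hat k N v x \<noteq> 0 \<longleftrightarrow> (\<forall>i\<le>Suc k. \<forall>j\<le>Suc k. (stretch k N x i - v i) - (stretch k N x j - v j) < 1)"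
proof -
  have "max 0 (1 - d) = 0 \<longleftrightarrow> \<not> d < 1" for d :: real by auto
  then show ?thesis
    unfolding hat_def by (simp add: prod_zero_iff del: prod.atMost_Suc) (meson atMost_iff)
qed

lemma continuous_on_hat: "continuous_on (Sph k) (hat k N v)"
  unfolding hat_def stretch_def
  by (intro continuous_on_prod continuous_on_max continuous_on_diff continuous_on_mult continuous_on_divide
      continuous_on_const continuous_on_sup_norm continuous_on_coordinate) 
    (force dest: sup_norm_pos)+

lemma stretch_above: "x \<in> Sph k \<Longrightarrow> i > k \<Longrightarrow> stretch k N x i = 0"
  by (simp add: stretch_def Sph_iff)

lemma stretch_integral:
  assumes "x \<in> Sph k"
  shows "\<exists>i\<le>k. x i \<noteq> 0 \<and> (stretch k N x i = real N \<or> stretch k N x i = - real N)"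
proof -
  obtain i where i: "i \<le> k" "sup_norm k x = \<bar>x i\<bar>" using sup_norm_attained by blast
  then show ?thesis using sup_norm_pos[OF assms]
    by (intro exI[of _ i]) (auto simp: stretch_def abs_if)
qed

lemma abs_stretch_le:
  assumes "x \<in> Sph k" "i \<le> k"
  shows "\<bar>stretch k N x i\<bar> \<le> real N"
proof -
  have "\<bar>x i\<bar> / sup_norm k x \<le> 1" using abs_le_sup_norm[OF assms(2)] sup_norm_pos[OF assms(1)] by simp
  then have "real N * (\<bar>x i\<bar> / sup_norm k x) \<le> real N * 1" by (intro mult_left_mono) auto
  then show ?thesis using sup_norm_pos[OF assms(1)] by (simp add: stretch_def abs_mult)
qed

text \<open>
  Rounding down gives a vertex of the cell that contains the point: fractional parts differ by
  less than 1.
\<close>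

lemma hat_cover:
  assumes "x \<in> Sph k" "N > 0"
  shows "\<exists>v\<in>lattice_pts k N. hat k N v x \<noteq> 0"
proof
  let ?v = "\<lambda>i. \<lfloor>stretch k N x i\<rfloor>"
  show "hat k N ?v x \<noteq> 0"
    unfolding hat_nonzero_iff
  proof (intro allI impI)
    fix i j show "(stretch k N x i - ?v i) - (stretch k N x j - ?v j) < 1" by linarith
  qed
  have "\<bar>?v i\<bar> \<le> int N" if "i \<le> k" for i
    using abs_stretch_le[OF assms(1) that, of N] by linarith
  moreover have "\<exists>i\<le>k. ?v i \<noteq> 0"
  proof -
    obtain i where "i \<le> k" "stretch k N x i = real N \<or> stretch k N x i = - real N"
      using stretch_integral[OF assms(1)] by blast
    then have "?v i \<noteq> 0" using assms(2) by (auto simp: floor_eq_iff)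
    then show ?thesis using \<open>i \<le> k\<close> by blast
  qed
  ultimately show "?v \<in> lattice_pts k N"
    using stretch_above[OF assms(1)] by (auto simp: lattice_pts_def)
qed

lemma hat_near:
  assumes x: "x \<in> Sph k" and v: "v \<in> lattice_pts k N" and h: "hat k N v x \<noteq> 0"
  shows "\<bar>stretch k N x i - v i\<bar> < 1"
proof (cases "i \<le> k")
  case True
  have 0: "stretch k N x (Suc k) = 0" "v (Suc k) = 0"
    using stretch_above[OF x] v by (auto simp: lattice_pts_def)
  show ?thesis
    using h[unfolded hat_nonzero_iff, rule_format, of i "Suc k"]
      h[unfolded hat_nonzero_iff, rule_format, of "Suc k" i] True 0 by auto
next
  case False
  then show ?thesis using stretch_above[OF x] v by (auto simp: lattice_pts_def)
qed

text \<open>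
  The vertices of a Freudenthal simplex form a chain in the coordinatewise order.
\<close>

lemma hat_chain:
  assumes "hat k N v x \<noteq> 0" "hat k N w x \<noteq> 0" "i \<le> k" "j \<le> k" "v i > w i"
  shows "w j \<le> v j"
proof (rule ccontr)
  assume "\<not> w j \<le> v j"
  then have "real_of_int (v j) + 1 \<le> w j" "real_of_int (w i) + 1 \<le> v i"
    using assms(5) by linarith+
  moreover have "(stretch k N x j - v j) - (stretch k N x i - v i) < 1"
    "(stretch k N x i - w i) - (stretch k N x j - w j) < 1"
    using assms(1-4) unfolding hat_nonzero_iff by auto
  ultimately show False by linarith
qed

text \<open>
  A vertex of the cell of \<open>u\<close> is obtained by rounding each coordinate down or up, and a chain
  of such vertices is determined by the number of coordinates that are rounded up. A point of the
  equator has two integral coordinates after stretching, the last one and one of maximal modulus,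
  which leaves at most \<open>k - 1\<close> coordinates with a choice, hence at most \<open>k\<close> vertices.
\<close>

lemma card_active_equator:
  assumes x: "x \<in> Sph k" and k: "k > 0" and xk: "x k = 0"
  shows "card {v \<in> lattice_pts k N. hat k N v x \<noteq> 0} \<le> k"
proof -
  let ?A = "{v \<in> lattice_pts k N. hat k N v x \<noteq> 0}"
  let ?s = "stretch k N x"
  obtain i0 where i0: "i0 \<le> k" "x i0 \<noteq> 0" "?s i0 = real N \<or> ?s i0 = - real N"
    using stretch_integral[OF x] by blast
  have "\<exists>z::int. ?s i0 = z"
    using i0(3) by (metis of_int_of_nat_eq of_int_minus)
  then obtain z :: int where z: "?s i0 = z" by blast
  have sk: "?s k = 0" using xk by (simp add: stretch_def)
  have "i0 \<noteq> k" using i0 xk by auto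
  \<comment> \<open>the number of coordinates that are rounded up\<close>
  define e where "e v = (\<Sum>i\<le>k. v i - \<lfloor>?s i\<rfloor>)" for v :: "nat \<Rightarrow> int"
  have near: "\<bar>?s i - v i\<bar> < 1" if "v \<in> ?A" for v i
    using hat_near[OF x, of v N] that by blast
  have range: "e v \<in> {0..int k - 1}" if v: "v \<in> ?A" for v
  proof -
    have b: "0 \<le> v i - \<lfloor>?s i\<rfloor>" "v i - \<lfloor>?s i\<rfloor> \<le> 1" for i
      using near[OF v, of i] by linarith+
    have "v i0 - \<lfloor>?s i0\<rfloor> = 0" using near[OF v, of i0] unfolding z by simp
    moreover have "v k - \<lfloor>?s k\<rfloor> = 0" using near[OF v, of k] unfolding sk by simp
    ultimately have "e v = (\<Sum>i\<in>{..k} - {i0, k}. v i - \<lfloor>?s i\<rfloor>)"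
      unfolding e_def by (intro sum.mono_neutral_right) auto
    also have "\<dots> \<le> (\<Sum>i\<in>{..k} - {i0, k}. 1)" by (intro sum_mono b)
    also have "\<dots> = int (card ({..k} - {i0, k}))" by simp
    also have "card ({..k} - {i0, k}) = k - 1"
      using i0(1) \<open>i0 \<noteq> k\<close> by (subst card_Diff_subset) auto
    finally have "e v \<le> int k - 1" using k by simp
    moreover have "0 \<le> e v" unfolding e_def by (intro sum_nonneg b)
    ultimately show ?thesis by simp
  qed
  have "inj_on e ?A"
  proof (rule inj_onI)
    have le: "v i \<le> w i" if v: "v \<in> ?A" and w: "w \<in> ?A" and ev: "e v = e w" and "i \<le> k" for v w i
    proof (rule ccontr)
      assume "\<not> v i \<le> w i"
      then have *: "w i < v i" by simp
      then have "w j \<le> v j" if "j \<le> k" for j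
        using hat_chain[of k N v x w i j] v w that \<open>i \<le> k\<close> by blast
      then have "e w < e v"
        unfolding e_def using * \<open>i \<le> k\<close> by (intro sum_strict_mono_ex1) auto
      then show False using ev by simp
    qed
    fix v w assume vw: "v \<in> ?A" "w \<in> ?A" "e v = e w"
    show "v = w"
    proof
      fix i show "v i = w i"
      proof (cases "i \<le> k")
        case True
        then show ?thesis using le[of v w i] le[of w v i] vw by simp
      next
        case False
        then show ?thesis using vw by (auto simp: lattice_pts_def)
      qed
    qed
  qed
  then have "card ?A \<le> card {0..int k - 1}"
    using range by (intro card_inj_on_le[of e]) auto
  then show ?thesis using k by simp
qed

text \<open>
  From \<open>|u - v|^2 = |u|^2 + |v|^2 - 2 |u| |v| cos \<theta> \<ge> 2 |u| |v| (1 - cos \<theta>)\<close>.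
\<close>

lemma to_sphere_dist_le:
  assumes "dot k u u > 0" "dot k v v > 0"
  shows "2 - 2 * dot k (to_sphere k u) (to_sphere k v)
    \<le> dot k (\<lambda>i. u i - v i) (\<lambda>i. u i - v i) / (sqrt (dot k u u) * sqrt (dot k v v))"
proof -
  define a b where "a = sqrt (dot k u u)" and "b = sqrt (dot k v v)"
  have ab: "a > 0" "b > 0" "dot k u u = a * a" "dot k v v = b * b"
    using assms by (auto simp: a_def b_def)
  have "dot k (to_sphere k u) (to_sphere k v) = (\<Sum>i\<le>k. (u i * v i) / (a * b))"
    unfolding dot_def[of k "to_sphere k u"] by (rule sum.cong) (auto simp: to_sphere_def a_def b_def)
  then have d: "dot k (to_sphere k u) (to_sphere k v) = dot k u v / (a * b)"
    by (simp add: dot_def sum_divide_distrib)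
  have "0 \<le> (a - b)\<^sup>2" by simp
  then have "(2 - 2 * (dot k u v / (a * b))) * (a * b) \<le> a * a + b * b - 2 * dot k u v"
    using ab by (simp add: field_simps power2_eq_square)
  also have "\<dots> = dot k (\<lambda>i. u i - v i) (\<lambda>i. u i - v i)"
    by (simp add: dot_diff ab dot_commute[of k v u])
  finally show ?thesis using ab d by (simp add: pos_le_divide_eq flip: a_def b_def)
qed

lemma int_vector_norm_ge_1:
  assumes "v \<in> lattice_pts k N"
  shows "1 \<le> dot k (\<lambda>i. real_of_int (v i)) (\<lambda>i. real_of_int (v i))"
proof -
  obtain i where i: "i \<le> k" "v i \<noteq> 0" using assms by (auto simp: lattice_pts_def)
  have "1 * 1 \<le> \<bar>v i\<bar> * \<bar>v i\<bar>" using i by (intro mult_mono) auto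
  then have "1 \<le> real_of_int (v i * v i)" by (simp only: of_int_1_le_iff abs_mult_self_eq)
  also have "\<dots> = real_of_int (v i) * real_of_int (v i)" by simp
  also have "\<dots> \<le> dot k (\<lambda>i. real_of_int (v i)) (\<lambda>i. real_of_int (v i))"
    unfolding dot_def using i by (intro member_le_sum) auto
  finally show ?thesis .
qed

lemma to_sphere_lattice_in_Sph: "v \<in> lattice_pts k N \<Longrightarrow> to_sphere k (\<lambda>i. real_of_int (v i)) \<in> Sph k"
  using int_vector_norm_ge_1[of v k N] by (intro to_sphere_in_Sph) auto

text \<open>
  In the cube a point is within bounded distance of the vertices of its cell, and the cube has
  size \<open>N\<close>; so after radial projection the cells become arbitrarily small.
\<close>

lemma hat_support_small:
  assumes x: "x \<in> Sph k" and v: "v \<in> lattice_pts k N" and h: "hat k N v x \<noteq> 0" and N: "N > 0"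
  shows "2 - 2 * dot k x (to_sphere k (\<lambda>i. real_of_int (v i))) \<le> (real k + 1) / real N"
proof -
  let ?u = "stretch k N x" and ?v = "\<lambda>i. real_of_int (v i)"
  define c where "c = real N / sup_norm k x"
  have c: "real N \<le> c" "c > 0"
    using sup_norm_pos[OF x] sup_norm_le_1[OF x] N by (auto simp: c_def field_simps mult_le_cancel_left1)
  have u: "?u = (\<lambda>i. c * x i)" by (simp add: stretch_def c_def)
  have uu: "dot k ?u ?u = c * c" using x by (simp add: u dot_scale Sph_iff)
  have un: "to_sphere k ?u = x" using to_sphere_scale[OF c(2)] to_sphere_Sph[OF x] by (simp add: u)
  have vv: "1 \<le> dot k ?v ?v" by (rule int_vector_norm_ge_1[OF v])
  have "dot k (\<lambda>i. ?u i - ?v i) (\<lambda>i. ?u i - ?v i) \<le> (\<Sum>i\<le>k. 1)"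
    unfolding dot_def
  proof (rule sum_mono)
    fix i
    have "\<bar>?u i - ?v i\<bar> * \<bar>?u i - ?v i\<bar> \<le> 1 * 1"
      using hat_near[OF x v h, of i] by (intro mult_mono) auto
    then show "(?u i - ?v i) * (?u i - ?v i) \<le> 1" by simp
  qed
  then have d: "dot k (\<lambda>i. ?u i - ?v i) (\<lambda>i. ?u i - ?v i) \<le> real k + 1" by simp
  have "2 - 2 * dot k x (to_sphere k ?v) \<le> dot k (\<lambda>i. ?u i - ?v i) (\<lambda>i. ?u i - ?v i) / (sqrt (dot k ?u ?u) * sqrt (dot k ?v ?v))"
    using to_sphere_dist_le[of k ?u ?v] vv c unfolding un uu by simp
  also have "\<dots> \<le> (real k + 1) / (real N * 1)"
  proof (rule frac_le)
    show "real N * 1 \<le> sqrt (dot k ?u ?u) * sqrt (dot k ?v ?v)"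
      using c vv by (intro mult_mono) (auto simp: uu)
  qed (use d N in auto)
  finally show ?thesis by simp
qed

text \<open>
  Uniform continuity, in the form that nearby points have images at an acute angle.
\<close>

lemma uniform_acute:
  assumes g: "continuous_on (Sph k) g" "g \<in> Sph k \<rightarrow> Sph l"
  obtains \<delta> where "\<delta> > 0"
    "\<And>x z. \<lbrakk>x \<in> Sph k; z \<in> Sph k; 2 - 2 * dot k x z < \<delta>\<rbrakk> \<Longrightarrow> dot l (g x) (g z) > 0"
proof -
  let ?S = "Sph k \<times> Sph k"
  define K where "K = {p \<in> ?S. dot l (g (fst p)) (g (snd p)) \<le> 0}"
  have cont: "continuous_on ?S (\<lambda>p. dot l (g (fst p)) (g (snd p)))"
    by (intro continuous_on_dot continuous_on_compose2[OF g(1)] continuous_on_fst continuous_on_snd continuous_on_id) auto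
  have "closedin (top_of_set ?S) (?S \<inter> (\<lambda>p. dot l (g (fst p)) (g (snd p))) -` {..0})"
    by (rule continuous_closedin_preimage[OF cont]) simp
  moreover have "?S \<inter> (\<lambda>p. dot l (g (fst p)) (g (snd p))) -` {..0} = K" by (auto simp: K_def)
  ultimately have K: "compact K"
    using closedin_compact[of ?S K] compact_Times[OF compact_Sph compact_Sph] by simp
  show thesis
  proof (cases "K = {}")
    case True
    show thesis
      by (rule that[of 1]) (use True in \<open>auto simp: K_def not_le\<close>)
  next
    case False
    have "continuous_on K (\<lambda>p. 2 - 2 * dot k (fst p) (snd p))"
      by (intro continuous_on_dot continuous_on_diff continuous_on_mult continuous_on_const continuous_on_fst continuous_on_snd continuous_on_id)
    from continuous_attains_inf[OF K False this]
    obtain p where p: "p \<in> K" and min: "\<And>q. q \<in> K \<Longrightarrow> 2 - 2 * dot k (fst p) (snd p) \<le> 2 - 2 * dot k (fst q) (snd q)"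
      by blast
    obtain x0 z0 where p0: "p = (x0, z0)" "x0 \<in> Sph k" "z0 \<in> Sph k" "dot l (g x0) (g z0) \<le> 0"
      using p by (cases p) (auto simp: K_def)
    show thesis
    proof
      show "2 - 2 * dot k x0 z0 > 0"
      proof (rule ccontr)
        assume "\<not> 2 - 2 * dot k x0 z0 > 0"
        then have "dot k (\<lambda>i. x0 i - z0 i) (\<lambda>i. x0 i - z0 i) = 0"
          using dot_diff_self[OF p0(2,3)] dot_self_nonneg[of k "\<lambda>i. x0 i - z0 i"] by simp
        then have "x0 = z0"
          using p0 by (intro Sph_eqI[of _ k]) (auto simp: dot_self_eq_0)
        moreover have "g x0 \<in> Sph l" using g(2) p0 by auto
        ultimately show False using p0(4) by (simp add: Sph_iff)
      qed
      fix x z assume "x \<in> Sph k" "z \<in> Sph k" "2 - 2 * dot k x z < 2 - 2 * dot k x0 z0"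
      then show "dot l (g x) (g z) > 0" using min[of "(x,z)"] p0 by (force simp: K_def)
    qed
  qed
qed

section \<open>The degree of odd maps\<close>

text \<open>
  The approximation step of Borsuk's theorem. Interpolating \<open>g\<close> from its values at the lattice
  points gives an odd \<open>h\<close>, close to \<open>g\<close>, that maps each point of the equator into the span
  of at most \<open>k\<close> of finitely many vectors. Hence \<open>h\<close> misses some line \<open>\<real> p\<close>
  with \<open>p k = 1\<close> on the equator. A shear carries \<open>p\<close> to the polar axis, and scaling the last coordinate by
  \<open>\<bar>x k\<bar>\<close> then pushes the image of the equator into the equator: the resulting
  vector could vanish only where \<open>x k = 0\<close> and \<open>h x\<close> lies on \<open>\<real> p\<close>.
\<close>

lemma odd_map_deform_to_equator:
  assumes g: "continuous_on (Sph k) g" "g \<in> Sph k \<rightarrow> Sph k"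
    and odd: "\<And>x. x \<in> Sph k \<Longrightarrow> g (\<lambda>i. - x i) = (\<lambda>i. - g x i)" and k: "k > 0"
  obtains g' where "continuous_on (Sph k) g'" "g' \<in> Sph k \<rightarrow> Sph k"
    "\<And>x. x \<in> Sph k \<Longrightarrow> g' (\<lambda>i. - x i) = (\<lambda>i. - g' x i)"
    "homotopic_with (\<lambda>_. True) (nsphere k) (nsphere k) g g'"
    "g' \<in> Sph (k - 1) \<rightarrow> Sph (k - 1)"
proof -
  obtain \<delta> where \<delta>: "\<delta> > 0"
    "\<And>x z. \<lbrakk>x \<in> Sph k; z \<in> Sph k; 2 - 2 * dot k x z < \<delta>\<rbrakk> \<Longrightarrow> dot k (g x) (g z) > 0"
    using uniform_acute[OF g] by blast
  obtain N :: nat where N: "real N > (real k + 1) / \<delta>" using reals_Archimedean2 by blast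
  moreover have "0 < (real k + 1) / \<delta>" using \<delta>(1) by simp
  ultimately have N0: "N > 0" by (cases "N = 0") auto
  have N\<delta>: "(real k + 1) / real N < \<delta>" using N N0 \<delta>(1) by (simp add: field_simps)
  define L where "L = lattice_pts k N"
  define q where "q v = g (to_sphere k (\<lambda>i. real_of_int (v i)))" for v :: "nat \<Rightarrow> int"
  define h where "h x = (\<lambda>i. \<Sum>v\<in>L. hat k N v x * q v i)" for x
  have finL: "finite L" by (simp add: L_def finite_lattice_pts)
  have q_minus: "q (\<lambda>i. - v i) = (\<lambda>i. - q v i)" if "v \<in> L" for v
    using odd[OF to_sphere_lattice_in_Sph[of v k N]] that
    by (simp add: q_def L_def flip: to_sphere_minus)
  have h_minus: "h (\<lambda>i. - x i) = (\<lambda>i. - h x i)" for x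
  proof
    fix i
    have "(\<Sum>v\<in>L. hat k N v (\<lambda>i. - x i) * q v i) = (\<Sum>v\<in>L. - (hat k N v x * q v i))"
    proof (rule sum.reindex_bij_witness[of _ "\<lambda>v i. - v i" "\<lambda>v i. - v i"])
      fix v assume v: "v \<in> L"
      have "hat k N (\<lambda>i. - v i) x = hat k N v (\<lambda>i. - x i)"
        using hat_minus[of k N "\<lambda>i. - v i" x] by simp
      then show "- (hat k N (\<lambda>i. - v i) x * q (\<lambda>i. - v i) i) = hat k N v (\<lambda>i. - x i) * q v i"
        by (simp add: q_minus[OF v])
    qed (auto simp: L_def minus_lattice_pts)
    then show "h (\<lambda>i. - x i) i = - h x i" by (simp add: h_def sum_negf)
  qed
  have h_cont: "continuous_on (Sph k) h"
    unfolding h_def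
    by (intro continuous_on_coordinatewise_then_product continuous_on_sum continuous_on_mult
        continuous_on_hat continuous_on_const)
  have hg: "dot k (h x) (g x) > 0" if x: "x \<in> Sph k" for x
  proof -
    have pos: "dot k (q v) (g x) > 0" if "v \<in> L" "hat k N v x \<noteq> 0" for v
    proof -
      have "2 - 2 * dot k (to_sphere k (\<lambda>i. real_of_int (v i))) x < \<delta>"
        using hat_support_small[OF x _ that(2) N0] that(1) N\<delta>
        by (simp add: L_def dot_commute[of k _ x])
      then show ?thesis unfolding q_def
        using \<delta>(2) to_sphere_lattice_in_Sph x that(1) by (simp add: L_def)
    qed
    obtain v0 where v0: "v0 \<in> L" "hat k N v0 x \<noteq> 0"
      using hat_cover[OF x N0] by (auto simp: L_def)
    have "0 < (\<Sum>v\<in>L. hat k N v x * dot k (q v) (g x))"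
    proof (rule sum_pos2[OF finL v0(1)])
      show "0 < hat k N v0 x * dot k (q v0) (g x)"
        using pos[OF v0] v0(2) hat_nonneg[of k N v0 x] by simp
      show "0 \<le> hat k N v x * dot k (q v) (g x)" if "v \<in> L" for v
        using pos[OF that] hat_nonneg[of k N v x] by (cases "hat k N v x = 0") auto
    qed
    also have "\<dots> = dot k (h x) (g x)"
      unfolding h_def by (simp only: dot_sum dot_scale)
    finally show ?thesis .
  qed
  obtain p where p: "p k = 1"
    "\<And>S w c. \<lbrakk>S \<subseteq> q ` L; card S \<le> k; \<And>i. i \<le> k \<Longrightarrow> (\<Sum>v\<in>S. w v * v i) = c * p i\<rbrakk> \<Longrightarrow> c = 0"
    using avoid_small_spans[of "q ` L" k] finL by auto
  \<comment> \<open>on the equator, \<open>h\<close> avoids the line spanned by \<open>p\<close>\<close>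
  have off_line: "c = 0"
    if x: "x \<in> Sph k" "x k = 0" and c: "\<And>i. i \<le> k \<Longrightarrow> h x i = c * p i" for x c
  proof -
    define A where "A = {v \<in> L. hat k N v x \<noteq> 0}"
    have finA: "finite A" using finL by (simp add: A_def)
    have cA: "card A \<le> k" using card_active_equator[OF x(1) k x(2), of N] by (simp add: A_def L_def)
    \<comment> \<open>\<open>q\<close> need not be injective, so weights of coinciding vectors are collected\<close>
    have sumA: "h x i = (\<Sum>s\<in>q ` A. (\<Sum>v | v \<in> A \<and> q v = s. hat k N v x) * s i)" for i
    proof -
      have "h x i = (\<Sum>v\<in>A. hat k N v x * q v i)"
        unfolding h_def A_def by (rule sum.mono_neutral_right) (use finL in auto)
      also have "\<dots> = (\<Sum>s\<in>q ` A. \<Sum>v | v \<in> A \<and> q v = s. hat k N v x * q v i)"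
        by (rule sum.image_gen[OF finA])
      finally show ?thesis by (simp add: sum_distrib_right)
    qed
    show "c = 0"
    proof (rule p(2)[of "q ` A" "\<lambda>s. \<Sum>v | v \<in> A \<and> q v = s. hat k N v x"])
      show "q ` A \<subseteq> q ` L" by (auto simp: A_def)
      show "card (q ` A) \<le> k" using card_image_le[OF finA, of q] cA by linarith
    qed (use c sumA in simp)
  qed
  \<comment> \<open>\<open>H1\<close> is the segment from \<open>g\<close> to \<open>h\<close>; \<open>H2\<close> performs the shear and the scaling\<close>
  define H1 where "H1 = (\<lambda>(s, x). \<lambda>i. (1 - s) * g x i + s * h x i)"
  define H2 where "H2 = (\<lambda>(s, x). \<lambda>i. if i < k then h x i - s * (h x k * p i)
      else ((1 - s) + s * \<bar>x k\<bar>) * h x k)"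
  let ?I = "{0..1::real} \<times> Sph k"
  have gI: "continuous_on ?I (\<lambda>z. g (snd z) i)" and hI: "continuous_on ?I (\<lambda>z. h (snd z) i)" for i
    by (rule continuous_on_coord, rule continuous_on_compose2[OF g(1)];
        auto intro: continuous_intros)
       (rule continuous_on_coord, rule continuous_on_compose2[OF h_cont];
        auto intro: continuous_intros)
  have xI: "continuous_on ?I (\<lambda>z. snd z i)" for i
    by (rule continuous_on_compose2[OF continuous_on_coordinate continuous_on_snd[OF continuous_on_id]]) auto
  have sI: "continuous_on ?I fst" by (rule continuous_on_fst[OF continuous_on_id])
  have H1_cont: "continuous_on ?I H1"
    unfolding H1_def case_prod_beta
    by (intro continuous_on_coordinatewise_then_product continuous_on_add continuous_on_mult
        continuous_on_diff continuous_on_const sI gI hI)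
  have H2_cont: "continuous_on ?I H2"
  proof (rule continuous_on_coordinatewise_then_product)
    fix i
    show "continuous_on ?I (\<lambda>z. H2 z i)"
      unfolding H2_def case_prod_beta
      by (cases "i < k"; simp only: if_True if_False;
          intro continuous_on_add continuous_on_mult continuous_on_rabs
          continuous_on_diff continuous_on_const sI hI xI)
  qed
  have nonzeroI: "dot k y y \<noteq> 0" if "dot k y z > 0" for y z
  proof
    assume "dot k y y = 0"
    then have "dot k y z = 0" by (simp add: dot_self_eq_0 dot_def[of k y z])
    then show False using that by simp
  qed
  have H1_nz: "dot k (H1 (s,x)) (H1 (s,x)) \<noteq> 0" if s: "0 \<le> s" "s \<le> 1" and x: "x \<in> Sph k" for s x
  proof (rule nonzeroI)
    have "dot k (g x) (g x) = 1" using g(2) x by (auto simp: Sph_iff Pi_iff)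
    then have "dot k (H1 (s,x)) (g x) = (1 - s) + s * dot k (h x) (g x)"
      by (simp add: H1_def dot_add dot_scale)
    also have "\<dots> > 0"
    proof (cases "s = 1")
      case False
      then show ?thesis using s hg[OF x] by (intro add_pos_nonneg) auto
    qed (use hg[OF x] in simp)
    finally show "dot k (H1 (s,x)) (g x) > 0" .
  qed
  have H2_nz: "dot k (H2 (s,x)) (H2 (s,x)) \<noteq> 0" if s: "0 \<le> s" "s \<le> 1" and x: "x \<in> Sph k" for s x
  proof
    assume "dot k (H2 (s,x)) (H2 (s,x)) = 0"
    then have z: "H2 (s,x) i = 0" if "i \<le> k" for i using that by (simp add: dot_self_eq_0)
    have z1: "h x i = s * (h x k * p i)" if "i < k" for i
      using z[of i] that by (simp add: H2_def)
    have z2: "((1 - s) + s * \<bar>x k\<bar>) * h x k = 0" using z[of k] by (simp add: H2_def)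
    have "h x k = 0"
    proof (cases "s = 1 \<and> x k = 0")
      case True
      show ?thesis
      proof (rule off_line[OF x])
        show "h x i = h x k * p i" if "i \<le> k" for i
          using z1[of i] True p(1) that by (cases "i = k") auto
      qed (use True in simp)
    next
      case False
      then have "(1 - s) + s * \<bar>x k\<bar> > 0"
        using s by (cases "s = 1") (auto intro!: add_pos_nonneg)
      then show ?thesis using z2 by simp
    qed
    then have "h x i = 0" if "i \<le> k" for i
      using z1[of i] that by (cases "i = k") auto
    then have "dot k (h x) (g x) = 0" by (simp add: dot_def)
    then show False using hg[OF x] by simp
  qed
  define g' where "g' x = to_sphere k (H2 (1, x))" for x
  have hom1: "homotopic_with (\<lambda>_. True) (nsphere k) (nsphere k) g (\<lambda>x. to_sphere k (h x))"
  proof (rule homotopic_with_eq[OF homotopic_to_sphere[OF H1_cont H1_nz]])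
    fix x assume "x \<in> topspace (nsphere k)"
    then show "g x = to_sphere k (H1 (0, x))"
      using funcset_mem[OF g(2)] to_sphere_Sph[of "g x" k] by (simp add: H1_def)
  qed (auto simp: H1_def)
  have hom2: "homotopic_with (\<lambda>_. True) (nsphere k) (nsphere k) (\<lambda>x. to_sphere k (h x)) g'"
  proof (rule homotopic_with_eq[OF homotopic_to_sphere[OF H2_cont H2_nz]])
    fix x assume "x \<in> topspace (nsphere k)"
    show "to_sphere k (h x) = to_sphere k (H2 (0, x))"
      by (rule to_sphere_cong) (auto simp: H2_def dest: le_neq_implies_less)
  qed (auto simp: g'_def)
  have cm: "continuous_map (nsphere k) (nsphere k) g'"
    using homotopic_with_imp_continuous_maps[OF hom2] by simp
  show thesis
  proof
    show cont': "continuous_on (Sph k) g'" and maps': "g' \<in> Sph k \<rightarrow> Sph k"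
      using cm by (auto simp: continuous_map_nsphere_iff)
    show "g' (\<lambda>i. - x i) = (\<lambda>i. - g' x i)" if "x \<in> Sph k" for x
    proof -
      have "H2 (1, \<lambda>i. - x i) = (\<lambda>i. - H2 (1, x) i)"
        by (auto simp: H2_def h_minus)
      then show ?thesis by (simp add: g'_def to_sphere_minus)
    qed
    show "homotopic_with (\<lambda>_. True) (nsphere k) (nsphere k) g g'"
      by (rule homotopic_with_trans[OF hom1 hom2])
    show "g' \<in> Sph (k - 1) \<rightarrow> Sph (k - 1)"
    proof
      fix x assume x: "x \<in> Sph (k - 1)"
      then have "x \<in> Sph k" using Sph_mono[of "k - 1" k] by auto
      moreover have "x k = 0" using x k by (simp add: Sph_iff)
      then have "g' x k = 0" by (simp add: g'_def to_sphere_def H2_def)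
      ultimately show "g' x \<in> Sph (k - 1)"
        using topspace_nsphere_minus1[of "g' x" k] maps' by auto
    qed
  qed
qed

text \<open>
  Borsuk's theorem. Once the map preserves the equator, its degree agrees modulo 2 with that of its
  restriction to the equator, which allows induction down to dimension 0, where an odd map is
  an involution.
\<close>

theorem odd_Brouwer_degree:
  assumes "continuous_map (nsphere k) (nsphere k) g"
    and "\<And>x. x \<in> Sph k \<Longrightarrow> g (\<lambda>i. - x i) = (\<lambda>i. - g x i)"
  shows "odd (Brouwer_degree2 k g)"
  using assms
proof (induction k arbitrary: g)
  case 0
  \<comment> \<open>an odd self-map of two points is the identity or the swap\<close>
  have "(g \<circ> g) x = id x" if x: "x \<in> Sph 0" for x
  proof -
    have y: "g x \<in> Sph 0" using 0(1) x by (auto simp: continuous_map_nsphere_iff)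
    have "(x 0 = 1 \<or> x 0 = -1) \<and> (g x 0 = 1 \<or> g x 0 = -1)"
      using x y by (auto simp: Sph_iff dot_def square_eq_1_iff)
    then have "g x 0 = x 0 \<or> g x 0 = - x 0" by auto
    then have "g x = x \<or> g x = (\<lambda>i. - x i)"
      using Sph_eqI[OF y x] Sph_eqI[OF y, of "\<lambda>i. - x i"] x by (auto simp: minus_in_Sph)
    then show ?thesis using 0(2)[OF x] by auto
  qed
  then have "Brouwer_degree2 0 (g \<circ> g) = Brouwer_degree2 0 id"
    by (rule Brouwer_degree2_eq)
  then have "Brouwer_degree2 0 g * Brouwer_degree2 0 g = 1"
    using Brouwer_degree2_compose[OF 0(1) 0(1)] by simp
  then show ?case by (metis even_mult_iff odd_one)
next
  case (Suc k)
  have g: "continuous_on (Sph (Suc k)) g" "g \<in> Sph (Suc k) \<rightarrow> Sph (Suc k)"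
    using Suc.prems(1) by (auto simp: continuous_map_nsphere_iff)
  obtain g' where g': "continuous_on (Sph (Suc k)) g'" "g' \<in> Sph (Suc k) \<rightarrow> Sph (Suc k)"
    "\<And>x. x \<in> Sph (Suc k) \<Longrightarrow> g' (\<lambda>i. - x i) = (\<lambda>i. - g' x i)"
    "homotopic_with (\<lambda>_. True) (nsphere (Suc k)) (nsphere (Suc k)) g g'"
    "g' \<in> Sph k \<rightarrow> Sph k"
    using odd_map_deform_to_equator[OF g Suc.prems(2)] by auto
  have sub: "Sph k \<subseteq> Sph (Suc k)" by (rule Sph_mono) simp
  have "even (Brouwer_degree2 (Suc k) g' - Brouwer_degree2 (Suc k - Suc 0) g')"
    using g' by (intro Borsuk_odd_mapping_degree_step) (auto simp: continuous_map_nsphere_iff)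
  moreover have "odd (Brouwer_degree2 k g')"
    using g' sub by (intro Suc.IH) (auto simp: continuous_map_nsphere_iff intro: continuous_on_subset)
  ultimately show ?case
    using Brouwer_degree2_homotopic[OF g'(4)] by simp
qed

text \<open>
  Followed by the inclusion of the equator, such a map would be an odd self-map of
  \<open>nsphere (Suc k)\<close> that is not surjective, hence of degree 0, which is even.
\<close>

theorem Borsuk_Ulam:
  assumes "continuous_map (nsphere (Suc k)) (nsphere k) f"
    and "odd_map (nsphere (Suc k)) antipode (nsphere k) antipode f"
  shows False
proof -
  have sub: "Sph k \<subseteq> Sph (Suc k)" by (rule Sph_mono) simp
  have f: "continuous_on (Sph (Suc k)) f" "f \<in> Sph (Suc k) \<rightarrow> Sph k"
    using assms(1) by (auto simp: continuous_map_nsphere_iff)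
  then have cm: "continuous_map (nsphere (Suc k)) (nsphere (Suc k)) f"
    using sub by (auto simp: continuous_map_nsphere_iff)
  let ?e = "\<lambda>i. if i = Suc k then 1 else 0 :: real"
  have "?e \<in> Sph (Suc k)"
    by (simp add: Sph_iff dot_def if_distrib[where f = "\<lambda>x. x * _"] cong: if_cong)
  moreover have "?e \<notin> f ` Sph (Suc k)"
  proof
    assume "?e \<in> f ` Sph (Suc k)"
    then have "?e \<in> Sph k" using f(2) by auto
    then have "?e (Suc k) = 0" unfolding Sph_iff by blast
    then show False by simp
  qed
  ultimately have "Brouwer_degree2 (Suc k) f = 0"
    using Brouwer_degree2_nonsurjective[OF cm] by blast
  moreover have "odd (Brouwer_degree2 (Suc k) f)"
    using assms(2) by (intro odd_Brouwer_degree[OF cm]) (simp add: odd_map_def antipode_def)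
  ultimately show False by simp
qed

section \<open>Maps out of and into geometric realizations\<close>

text \<open>
  This is the universal property of the weak topology.
\<close>

lemma continuous_map_from_realization:
  assumes "\<And>s. s \<in> K \<Longrightarrow> continuous_map (top_of_set (closed_simplex s)) Y f"
  shows "continuous_map (geometric_realization K) Y f"
  unfolding continuous_map_def
proof (intro conjI allI impI)
  show "f \<in> topspace (geometric_realization K) \<rightarrow> topspace Y"
    using assms by (fastforce simp: topspace_geometric_realization continuous_map_def)
  fix U assume U: "openin Y U"
  let ?P = "{x \<in> topspace (geometric_realization K). f x \<in> U}"
  have "openin (top_of_set (closed_simplex s)) (?P \<inter> closed_simplex s)" if "s \<in> K" for s
  proof -
    have "openin (top_of_set (closed_simplex s)) {x \<in> closed_simplex s. f x \<in> U}"
      using assms[OF that] U by (auto simp: continuous_map_def)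
    moreover have "?P \<inter> closed_simplex s = {x \<in> closed_simplex s. f x \<in> U}"
      using that by (auto simp: topspace_geometric_realization)
    ultimately show ?thesis by simp
  qed
  then show "openin (geometric_realization K) ?P"
    by (auto simp: openin_geometric_realization topspace_geometric_realization euclidean_product_topology)
qed

lemma closed_closed_simplex: "finite s \<Longrightarrow> closed (closed_simplex s)"
proof -
  assume "finite s"
  have "closed_simplex s = (\<Inter>v. {p. 0 \<le> p v}) \<inter> (\<Inter>v\<in>-s. {p. p v = 0}) \<inter> {p. (\<Sum>v\<in>s. p v) = 1}"
    by (auto simp: closed_simplex_def)
  moreover have c: "continuous_on UNIV (\<lambda>p :: 'a \<Rightarrow> real. p v)" for v
    by (rule continuous_on_product_coordinates)
  have "closed (\<Inter>v. {p :: 'a \<Rightarrow> real. 0 \<le> p v})"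
    by (intro closed_INT ballI closed_Collect_le continuous_on_const c)
  moreover have "closed (\<Inter>v\<in>-s. {p :: 'a \<Rightarrow> real. p v = 0})"
    by (intro closed_INT ballI closed_Collect_eq continuous_on_const c)
  moreover have "closed {p :: 'a \<Rightarrow> real. (\<Sum>v\<in>s. p v) = 1}"
    by (intro closed_Collect_eq continuous_on_sum continuous_on_const c)
  ultimately show ?thesis by (simp add: closed_Int)
qed

lemma closed_trace_realization:
  assumes "closedin (geometric_realization K) C" "s \<in> K" "finite s"
  shows "closed (C \<inter> closed_simplex s)"
proof -
  let ?T = "topspace (geometric_realization K)"
  have "openin (geometric_realization K) (?T - C)" using assms(1) by (simp add: closedin_def)
  then have "openin (top_of_set (closed_simplex s)) ((?T - C) \<inter> closed_simplex s)"
    using assms(2) by (simp add: openin_geometric_realization euclidean_product_topology)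
  moreover have "C \<inter> closed_simplex s = closed_simplex s - (?T - C) \<inter> closed_simplex s"
    using assms(2) by (auto simp: topspace_geometric_realization)
  ultimately have "closedin (top_of_set (closed_simplex s)) (C \<inter> closed_simplex s)"
    by (simp add: closedin_def) (metis Diff_Diff_Int Int_commute Int_lower1 inf.absorb_iff2)
  then show ?thesis
    using closed_closed_simplex[OF assms(3)] closedin_closed_trans by blast
qed

text \<open>
  Over a finite vertex set the weak topology is no finer than the Euclidean one, because closed
  sets are finite unions of their traces on the closed simplices.
\<close>

lemma continuous_map_into_realization:
  assumes V: "finite V" and cont: "continuous_map X euclidean f"
    and f: "\<And>x. x \<in> topspace X \<Longrightarrow> \<exists>s\<in>K. s \<subseteq> V \<and> f x \<in> closed_simplex s"
  shows "continuous_map X (geometric_realization K) f"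
  unfolding continuous_map_closedin
proof (intro conjI allI impI)
  show "f \<in> topspace X \<rightarrow> topspace (geometric_realization K)"
    using f by (auto simp: topspace_geometric_realization)
  fix C assume C: "closedin (geometric_realization K) C"
  let ?S = "{s \<in> K. s \<subseteq> V}"
  have "closedin X {x \<in> topspace X. f x \<in> C \<inter> closed_simplex s}" if "s \<in> ?S" for s
    using closed_trace_realization[OF C, of s] that V cont finite_subset[of s V]
    by (intro closedin_continuous_map_preimage[OF cont]) auto
  moreover have "finite ?S" using V by simp
  ultimately have "closedin X (\<Union>s\<in>?S. {x \<in> topspace X. f x \<in> C \<inter> closed_simplex s})"
    by (intro closedin_Union) auto
  moreover have "(\<Union>s\<in>?S. {x \<in> topspace X. f x \<in> C \<inter> closed_simplex s}) = {x \<in> topspace X. f x \<in> C}"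
    using f by blast
  ultimately show "closedin X {x \<in> topspace X. f x \<in> C}" by simp
qed

section \<open>The lower bound\<close>

lemma antipode_antipode [simp]: "antipode (antipode x) = x"
  by (simp add: antipode_def)

lemma dot_antipode: "dot k (antipode x) y = - dot k x y" "dot k x (antipode y) = - dot k x y"
  unfolding antipode_def by (rule dot_minus)+

lemma realization_map_antipode: "realization_map antipode p = (\<lambda>w. p (antipode w))"
proof
  fix w :: "nat \<Rightarrow> real"
  have "{v. p v \<noteq> 0 \<and> antipode v = w} = (if p (antipode w) \<noteq> 0 then {antipode w} else {})"
    by (auto simp: antipode_def)
  then show "realization_map antipode p w = p (antipode w)"
    by (simp add: realization_map_def)
qed

lemma geodesic_dist_le_iff:
  assumes "x \<in> Sph m" "y \<in> Sph m" "0 \<le> r" "r \<le> pi"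
  shows "geodesic_dist m x y \<le> r \<longleftrightarrow> cos r \<le> dot m x y"
proof -
  have b: "- 1 \<le> dot m x y" "dot m x y \<le> 1" using abs_dot_le_1[OF assms(1,2)] by auto
  have g: "geodesic_dist m x y = arccos (dot m x y)" by (simp add: geodesic_dist_def dot_def)
  have "arccos (dot m x y) \<le> r \<longleftrightarrow> cos r \<le> cos (arccos (dot m x y))"
    using assms b by (intro cos_mono_le_eq[symmetric]) (auto simp: arccos_lbound arccos_ubound)
  then show ?thesis using b g by simp
qed

lemma VR_sphere_simplex_iff:
  assumes "0 \<le> r" "r \<le> pi"
  shows "s \<in> VR_simplices (Sph m) (geodesic_dist m) r \<longleftrightarrow>
    finite s \<and> s \<noteq> {} \<and> s \<subseteq> Sph m \<and> (\<forall>x\<in>s. \<forall>y\<in>s. cos r \<le> dot m x y)"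
proof -
  have "diam (geodesic_dist m) s \<le> r \<longleftrightarrow> (\<forall>x\<in>s. \<forall>y\<in>s. cos r \<le> dot m x y)"
    if "finite s" "s \<noteq> {}" "s \<subseteq> Sph m"
    using that assms by (subst diam_le_iff) (auto simp: geodesic_dist_le_iff subset_iff)
  then show ?thesis by (auto simp: VR_simplices_def)
qed

text \<open>
  Let \<open>A\<close> be the second moment matrix of the weights \<open>p\<close>: it has trace
  1, so \<open>tr (A^2) \<ge> 1 / (m + 1)\<close>. On the other hand \<open>tr (A^2)\<close> is the average of
  \<open>\<langle>v, w\<rangle>^2\<close>, and \<open>(\<langle>v, w\<rangle> - c) (1 - \<langle>v, w\<rangle>) \<ge> 0\<close> bounds it by
  \<open>(1 + c)\<close> times the average of \<open>\<langle>v, w\<rangle>\<close>, minus \<open>c\<close>. If the barycenter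
  vanishes, that average is 0 and \<open>1 / (m + 1) \<le> - c\<close>.
\<close>

lemma barycenter_nonzero:
  assumes s: "finite s" "s \<subseteq> Sph m"
    and c: "\<And>v w. \<lbrakk>v \<in> s; w \<in> s\<rbrakk> \<Longrightarrow> c \<le> dot m v w" "c > - 1 / (real m + 1)"
    and p: "\<And>v. v \<in> s \<Longrightarrow> 0 \<le> p v" "(\<Sum>v\<in>s. p v) = 1"
  shows "dot m (\<lambda>i. \<Sum>v\<in>s. p v * v i) (\<lambda>i. \<Sum>v\<in>s. p v * v i) \<noteq> 0"
proof
  let ?y = "\<lambda>i. \<Sum>v\<in>s. p v * v i"
  assume "dot m ?y ?y = 0"
  then have y0: "(\<Sum>v\<in>s. \<Sum>w\<in>s. p v * p w * dot m v w) = 0"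
    by (simp only: dot_sum dot_scale) (simp add: sum_distrib_left mult.assoc)
  define A where "A i j = (\<Sum>v\<in>s. p v * (v i * v j))" for i j
  have "1 = (\<Sum>v\<in>s. p v * dot m v v)"
    using p(2) s(2) by (auto simp: Sph_iff subset_iff intro!: sum.cong)
  also have "\<dots> = (\<Sum>i\<le>m. A i i)"
    by (simp add: dot_def A_def sum_distrib_left sum.swap[of _ s "{..m}"])
  finally have "1 = (\<Sum>i\<le>m. A i i)\<^sup>2" by simp
  also have "\<dots> \<le> (\<Sum>i\<le>m. (A i i)\<^sup>2) * card {..m}"
    by (rule sum_squared_le_sum_of_squares)
  also have "\<dots> \<le> (\<Sum>i\<le>m. \<Sum>j\<le>m. (A i j)\<^sup>2) * card {..m}"
    by (intro mult_right_mono sum_mono member_le_sum[of _ _ "\<lambda>j. (A _ j)\<^sup>2"]) auto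
  also have "(\<Sum>i\<le>m. \<Sum>j\<le>m. (A i j)\<^sup>2) = (\<Sum>v\<in>s. \<Sum>w\<in>s. p v * p w * (dot m v w)\<^sup>2)"
  proof -
    have "(\<Sum>i\<le>m. \<Sum>j\<le>m. (A i j)\<^sup>2) =
        (\<Sum>i\<le>m. \<Sum>j\<le>m. \<Sum>v\<in>s. \<Sum>w\<in>s. p v * p w * ((v i * w i) * (v j * w j)))"
      unfolding A_def power2_eq_square sum_product by (simp add: mult_ac)
    also have "\<dots> = (\<Sum>v\<in>s. \<Sum>w\<in>s. \<Sum>i\<le>m. \<Sum>j\<le>m. p v * p w * ((v i * w i) * (v j * w j)))"
      by (simp add: sum.swap[of _ s "{..m}"])
    also have "\<dots> = (\<Sum>v\<in>s. \<Sum>w\<in>s. p v * p w * (dot m v w)\<^sup>2)"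
      unfolding dot_def power2_eq_square sum_product by (simp add: sum_distrib_left)
    finally show ?thesis .
  qed
  also have "\<dots> \<le> (\<Sum>v\<in>s. \<Sum>w\<in>s. p v * p w * ((1 + c) * dot m v w - c))"
  proof (intro sum_mono mult_left_mono)
    fix v w assume vw: "v \<in> s" "w \<in> s"
    have "dot m v w \<le> 1" using abs_dot_le_1[of v m w] vw s(2) by (auto simp: subset_iff)
    then have "0 \<le> (dot m v w - c) * (1 - dot m v w)" using c(1)[OF vw] by simp
    then show "(dot m v w)\<^sup>2 \<le> (1 + c) * dot m v w - c"
      by (simp add: power2_eq_square algebra_simps)
  qed (use p(1) in auto)
  also have "\<dots> = (\<Sum>v\<in>s. \<Sum>w\<in>s. (1 + c) * (p v * p w * dot m v w) - c * (p v * p w))"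
    by (simp add: algebra_simps)
  also have "\<dots> = (1 + c) * (\<Sum>v\<in>s. \<Sum>w\<in>s. p v * p w * dot m v w) - c * (\<Sum>v\<in>s. \<Sum>w\<in>s. p v * p w)"
    by (simp only: sum_subtractf sum_distrib_left[symmetric])
  also have "(\<Sum>v\<in>s. \<Sum>w\<in>s. p v * p w) = 1"
    using p(2) by (simp flip: sum_product)
  finally have "1 \<le> - c * (real m + 1)" using y0 by (simp add: mult_right_mono add.commute)
  moreover have "- c * (real m + 1) < 1 / (real m + 1) * (real m + 1)"
    using c(2) by (intro mult_strict_right_mono) auto
  ultimately show False by simp
qed

text \<open>
  The affine extension of the inclusion of the sphere into its ambient space. Summing over the
  support makes it independent of the simplex in which the point is placed.
\<close>

definition support_sum :: "((nat \<Rightarrow> real) \<Rightarrow> real) \<Rightarrow> nat \<Rightarrow> real" where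
  "support_sum p = (\<lambda>i. \<Sum>v | p v \<noteq> 0. p v * v i)"

lemma support_sum_simplex:
  assumes "finite s" "p \<in> closed_simplex s"
  shows "support_sum p = (\<lambda>i. \<Sum>v\<in>s. p v * v i)"
  using assms unfolding support_sum_def
  by (intro ext sum.mono_neutral_left) (auto simp: closed_simplex_def)

lemma support_sum_antipode:
  "support_sum (\<lambda>w. p (antipode w)) = (\<lambda>i. - support_sum p i)"
proof
  fix i
  have "(\<Sum>v | p (antipode v) \<noteq> 0. p (antipode v) * v i) = (\<Sum>v | p v \<noteq> 0. - (p v * v i))"
    by (rule sum.reindex_bij_witness[of _ antipode antipode]) (auto simp: antipode_def)
  then show "support_sum (\<lambda>w. p (antipode w)) i = - support_sum p i"
    by (simp add: support_sum_def sum_negf)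
qed

lemma coind_geI:
  assumes "continuous_map (nsphere k) T f" "odd_map (nsphere k) antipode T \<nu> f"
  shows "enat k \<le> coind T \<nu>"
  unfolding coind_def using assms by (intro Sup_upper) blast

lemma coind_geD:
  assumes "enat n \<le> coind T \<nu>" "n > 0"
  obtains k f where "n \<le> k" "continuous_map (nsphere k) T f" "odd_map (nsphere k) antipode T \<nu> f"
proof -
  have "enat (n - 1) < enat n" using assms(2) by simp
  then have "enat (n - 1) < coind T \<nu>" using assms(1) by (rule less_le_trans)
  then obtain k f where "enat (n - 1) < enat k" "continuous_map (nsphere k) T f" "odd_map (nsphere k) antipode T \<nu> f"
    unfolding coind_def less_Sup_iff by blast
  then show thesis using that[of k f] by simp
qed

text \<open>
  Below the critical scale, barycenters followed by radial projection give an odd map back to the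
  sphere, so an odd map from a sphere of larger dimension into the complex would contradict
  the Borsuk-Ulam theorem.
\<close>

lemma coind_VR_sphere_below:
  assumes r: "0 \<le> r" "r < arccos (- 1 / (real m + 1))"
  shows "\<not> enat (Suc m) \<le> coind (VR_sphere m r) (realization_map antipode)"
proof
  assume "enat (Suc m) \<le> coind (VR_sphere m r) (realization_map antipode)"
  then obtain k f where k: "Suc m \<le> k" and f: "continuous_map (nsphere k) (VR_sphere m r) f"
    and odd: "odd_map (nsphere k) antipode (VR_sphere m r) (realization_map antipode) f"
    by (rule coind_geD) simp_all
  have b: "- 1 \<le> - 1 / (real m + 1)" "- 1 / (real m + 1) \<le> 1" by (auto simp: field_simps)
  have rpi: "r \<le> pi" using r(2) arccos_ubound[OF b] by linarith
  have "cos (arccos (- 1 / (real m + 1))) < cos r"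
    using r rpi arccos_ubound[OF b] by (intro cos_monotone_0_pi) auto
  then have c: "cos r > - 1 / (real m + 1)" using b by simp
  let ?K = "VR_simplices (Sph m) (geodesic_dist m) r"
  define F where "F p = to_sphere m (support_sum p)" for p
  have simplex: "finite s \<and> (\<forall>p\<in>closed_simplex s. dot m (support_sum p) (support_sum p) \<noteq> 0)" if "s \<in> ?K" for s
  proof -
    have s: "finite s" "s \<subseteq> Sph m" "\<And>v w. \<lbrakk>v \<in> s; w \<in> s\<rbrakk> \<Longrightarrow> cos r \<le> dot m v w"
      using that VR_sphere_simplex_iff[OF r(1) rpi] by auto
    have "dot m (support_sum p) (support_sum p) \<noteq> 0" if p: "p \<in> closed_simplex s" for p
      unfolding support_sum_simplex[OF s(1) p]
      using s c p by (intro barycenter_nonzero[of _ _ "cos r"]) (auto simp: closed_simplex_def)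
    then show ?thesis using s(1) by blast
  qed
  have Fcont: "continuous_map (VR_sphere m r) (nsphere m) F"
    unfolding VR_sphere_def VR_def
  proof (rule continuous_map_from_realization)
    fix s assume s: "s \<in> ?K"
    have "continuous_on (closed_simplex s) (\<lambda>p i. \<Sum>v\<in>s. p v * v i)"
      by (intro continuous_on_coordinatewise_then_product continuous_on_sum continuous_on_mult
          continuous_on_const continuous_on_subset[OF continuous_on_product_coordinates]) auto
    then have "continuous_on (closed_simplex s) support_sum"
      using support_sum_simplex simplex[OF s] by (subst continuous_on_cong[OF refl]) auto
    then have "continuous_on (closed_simplex s) F"
      unfolding F_def using simplex[OF s] by (intro continuous_on_to_sphere) auto
    moreover have "F \<in> closed_simplex s \<rightarrow> Sph m"
      using simplex[OF s] by (auto simp: F_def intro!: to_sphere_in_Sph)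
    ultimately show "continuous_map (top_of_set (closed_simplex s)) (nsphere m) F"
      using continuous_map_subtopology_eu[of "closed_simplex s" "Sph m" F]
      by (simp add: image_subset_iff_funcset flip: nsphere_eq_top_of_set)
  qed
  have sub: "Sph (Suc m) \<subseteq> Sph k" by (rule Sph_mono[OF k])
  have "continuous_map (nsphere (Suc m)) (VR_sphere m r) f"
    using continuous_map_from_subtopology_mono[OF _ sub, of euclidean] f
    by (simp flip: nsphere_eq_top_of_set)
  then have "continuous_map (nsphere (Suc m)) (nsphere m) (F \<circ> f)"
    using Fcont by (rule continuous_map_compose)
  moreover have "odd_map (nsphere (Suc m)) antipode (nsphere m) antipode (F \<circ> f)"
    unfolding odd_map_def
  proof
    fix x assume "x \<in> Sph (Suc m)"
    then have "f (antipode x) = (\<lambda>w. f x (antipode w))"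
      using odd sub by (auto simp: odd_map_def realization_map_antipode)
    then show "(F \<circ> f) (antipode x) = antipode ((F \<circ> f) x)"
      by (simp add: F_def support_sum_antipode to_sphere_minus) (simp add: antipode_def)
  qed
  ultimately show False by (rule Borsuk_Ulam)
qed

section \<open>Odd maps into the Vietoris-Rips complex of a sphere\<close>

text \<open>
  Both upper bounds use this construction of odd maps into the complex by normalized weights: at
  \<open>x\<close>, the vertex \<open>q i\<close> gets weight \<open>g i x\<close> and its antipode gets weight
  \<open>g i (antipode x)\<close>, which makes the map odd by design. It then suffices that
  simultaneously active vertices are within distance \<open>r\<close>. Different indices may carry the
  same vertex, and their weights are added.
\<close>

lemma coind_VR_sphere_ge:
  fixes I :: "'i set" and q :: "'i \<Rightarrow> nat \<Rightarrow> real" and g :: "'i \<Rightarrow> (nat \<Rightarrow> real) \<Rightarrow> real"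
  assumes r: "0 \<le> r" "r \<le> pi" and I: "finite I"
    and q: "\<And>i. i \<in> I \<Longrightarrow> q i \<in> Sph m"
    and g_cont: "\<And>i. i \<in> I \<Longrightarrow> continuous_on (Sph k) (g i)"
    and g_nonneg: "\<And>i x. i \<in> I \<Longrightarrow> 0 \<le> g i x"
    and cover: "\<And>x. x \<in> Sph k \<Longrightarrow> \<exists>i\<in>I. 0 < g i x \<or> 0 < g i (antipode x)"
    and same: "\<And>i j x. \<lbrakk>i \<in> I; j \<in> I; x \<in> Sph k; 0 < g i x; 0 < g j x\<rbrakk> \<Longrightarrow> cos r \<le> dot m (q i) (q j)"
    and opposite: "\<And>i j x. \<lbrakk>i \<in> I; j \<in> I; x \<in> Sph k; 0 < g i x; 0 < g j (antipode x)\<rbrakk>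
      \<Longrightarrow> dot m (q i) (q j) \<le> - cos r"
  shows "enat k \<le> coind (VR_sphere m r) (realization_map antipode)"
proof -
  define tot where "tot x = (\<Sum>i\<in>I. g i x + g i (antipode x))" for x
  define num where "num x w = (\<Sum>i\<in>I. (if q i = w then g i x else 0) +
      (if antipode (q i) = w then g i (antipode x) else 0))" for x w
  define f where "f x = (\<lambda>w. num x w / tot x)" for x
  define V where "V = q ` I \<union> antipode ` q ` I"
  define s where "s x = {w \<in> V. f x w \<noteq> 0}" for x
  have finV: "finite V" using I by (simp add: V_def)
  have tot: "0 < tot x" if x: "x \<in> Sph k" for x
  proof -
    obtain i where "i \<in> I" "0 < g i x \<or> 0 < g i (antipode x)" using cover[OF x] by blast
    then show ?thesis unfolding tot_def
      using g_nonneg by (intro sum_pos2[OF I, of i]) (auto intro: add_pos_nonneg add_nonneg_pos)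
  qed
  have num_nonneg: "0 \<le> num x w" for x w
    unfolding num_def using g_nonneg by (intro sum_nonneg) auto
  have num_outside: "num x w = 0" if "w \<notin> V" for x w
    unfolding num_def using that by (intro sum.neutral) (auto simp: V_def)
  have num_active: "\<exists>i\<in>I. (w = q i \<and> 0 < g i x) \<or> (w = antipode (q i) \<and> 0 < g i (antipode x))"
    if "num x w \<noteq> 0" for x w
  proof (rule ccontr)
    assume neg: "\<not> ?thesis"
    have "num x w = 0"
      unfolding num_def
    proof (rule sum.neutral, rule ballI)
      fix i assume i: "i \<in> I"
      have "w = q i \<Longrightarrow> g i x = 0" "w = antipode (q i) \<Longrightarrow> g i (antipode x) = 0"
        using neg i g_nonneg[OF i, of x] g_nonneg[OF i, of "antipode x"] by (auto simp: less_le)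
      then show "(if q i = w then g i x else 0) + (if antipode (q i) = w then g i (antipode x) else 0) = 0"
        by auto
    qed
    then show False using that by simp
  qed
  have num_sum: "(\<Sum>w\<in>V. num x w) = tot x" for x
  proof -
    have "(\<Sum>w\<in>V. num x w) = (\<Sum>i\<in>I. (\<Sum>w\<in>V. if q i = w then g i x else 0) +
        (\<Sum>w\<in>V. if antipode (q i) = w then g i (antipode x) else 0))"
      unfolding num_def by (subst sum.swap) (simp add: sum.distrib)
    also have "\<dots> = tot x"
      unfolding tot_def using finV by (intro sum.cong) (auto simp: V_def)
    finally show ?thesis .
  qed
  have f_simplex: "f x \<in> closed_simplex (s x)" if x: "x \<in> Sph k" for x
  proof -
    have "(\<Sum>w\<in>s x. f x w) = (\<Sum>w\<in>V. f x w)"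
      unfolding s_def by (rule sum.mono_neutral_left) (use finV in auto)
    also have "\<dots> = 1"
      using tot[OF x] by (simp add: f_def num_sum flip: sum_divide_distrib)
    finally show ?thesis
      using tot[OF x] num_nonneg num_outside by (auto simp: closed_simplex_def s_def f_def)
  qed
  have s_simplex: "s x \<in> VR_simplices (Sph m) (geodesic_dist m) r" if x: "x \<in> Sph k" for x
    unfolding VR_sphere_simplex_iff[OF r]
  proof (intro conjI ballI)
    show "finite (s x)" using finV by (simp add: s_def)
    show "s x \<noteq> {}" using f_simplex[OF x] by (auto simp: closed_simplex_def)
    show "s x \<subseteq> Sph m" using q by (auto simp: s_def V_def antipode_in_Sph)
    have x': "antipode x \<in> Sph k" using x by (simp add: antipode_in_Sph)
    have active: "\<exists>i\<in>I. (w = q i \<and> 0 < g i x) \<or> (w = antipode (q i) \<and> 0 < g i (antipode x))" if "w \<in> s x" for w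
      using that num_active[of x w] by (auto simp: s_def f_def)
    fix w w' assume "w \<in> s x" "w' \<in> s x"
    then obtain i j where ij: "i \<in> I" "j \<in> I"
      and i: "(w = q i \<and> 0 < g i x) \<or> (w = antipode (q i) \<and> 0 < g i (antipode x))"
      and j: "(w' = q j \<and> 0 < g j x) \<or> (w' = antipode (q j) \<and> 0 < g j (antipode x))"
      using active by metis
    from i j show "cos r \<le> dot m w w'"
      using same[OF ij x] same[OF ij x'] opposite[OF ij x] opposite[OF ij(2,1) x]
      by (auto simp: dot_antipode dot_commute[of m "q j" "q i"])
  qed
  have "continuous_on (Sph k) f"
    unfolding f_def
  proof (intro continuous_on_coordinatewise_then_product continuous_on_divide)
    have anti: "continuous_on (Sph k) (\<lambda>x. g i (antipode x))" if "i \<in> I" for i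
      unfolding antipode_def
      by (rule continuous_on_compose2[OF g_cont[OF that]])
        (auto simp: minus_in_Sph intro!: continuous_on_coordinatewise_then_product continuous_on_minus continuous_on_coordinate)
    show "continuous_on (Sph k) tot"
      unfolding tot_def by (intro continuous_on_sum continuous_on_add g_cont anti)
    show "continuous_on (Sph k) (\<lambda>x. num x w)" for w
      unfolding num_def
    proof (intro continuous_on_sum continuous_on_add)
      fix i assume "i \<in> I"
      then show "continuous_on (Sph k) (\<lambda>x. if q i = w then g i x else 0)"
        "continuous_on (Sph k) (\<lambda>x. if antipode (q i) = w then g i (antipode x) else 0)"
        using g_cont anti by (cases "q i = w"; cases "antipode (q i) = w"; simp)+
    qed
    show "\<forall>x\<in>Sph k. tot x \<noteq> 0" using tot by (metis less_irrefl)
  qed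
  then have "continuous_map (nsphere k) euclidean f"
    by (subst nsphere_eq_top_of_set) simp
  then have cont: "continuous_map (nsphere k) (VR_sphere m r) f"
    unfolding VR_sphere_def VR_def
  proof (intro continuous_map_into_realization[OF finV])
    fix x assume "x \<in> topspace (nsphere k)"
    moreover have "s x \<subseteq> V" by (auto simp: s_def)
    ultimately show "\<exists>t\<in>VR_simplices (Sph m) (geodesic_dist m) r. t \<subseteq> V \<and> f x \<in> closed_simplex t"
      using f_simplex s_simplex by blast
  qed
  have tot_antipode: "tot (antipode x) = tot x" for x
    by (simp add: tot_def add.commute)
  have anti_eq: "antipode a = b \<longleftrightarrow> a = antipode b" for a b
    by (metis antipode_antipode)
  have num_antipode: "num (antipode x) w = num x (antipode w)" for x w
    unfolding num_def by (intro sum.cong) (auto simp: anti_eq)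
  have "odd_map (nsphere k) antipode (VR_sphere m r) (realization_map antipode) f"
    by (simp add: odd_map_def realization_map_antipode f_def tot_antipode num_antipode)
  with cont show ?thesis by (rule coind_geI)
qed

section \<open>The critical scale of the regular simplex\<close>

lemma finite_net:
  assumes "\<epsilon> > 0"
  obtains V where "finite V" "V \<subseteq> Sph m" "\<And>x. x \<in> Sph m \<Longrightarrow> \<exists>v\<in>V. 1 - \<epsilon> < dot m x v"
proof -
  have "\<exists>V\<subseteq>Sph m. finite V \<and> Sph m \<subseteq> (\<Union>v\<in>V. {x. 1 - \<epsilon> < dot m x v})"
  proof (rule compactE_image[OF compact_Sph, of "Sph m" "\<lambda>v. {x. 1 - \<epsilon> < dot m x v}" m])
    show "open {x. 1 - \<epsilon> < dot m x v}" for v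
      by (intro open_Collect_less continuous_on_const continuous_on_dot continuous_on_id)
    show "Sph m \<subseteq> (\<Union>v\<in>Sph m. {x. 1 - \<epsilon> < dot m x v})"
      using assms by (auto simp: Sph_iff intro!: bexI)
  qed auto
  then obtain V where V: "V \<subseteq> Sph m" "finite V" "Sph m \<subseteq> (\<Union>v\<in>V. {x. 1 - \<epsilon> < dot m x v})"
    by blast
  show thesis
    by (rule that[of V]) (use V in auto)
qed

text \<open>
  For \<open>d = m + 1\<close>, the vertices are multiples of the standard basis vectors shifted along the
  diagonal, and a negative multiple of the diagonal.
\<close>

lemma regular_simplex:
  obtains \<sigma> :: "nat \<Rightarrow> nat \<Rightarrow> real" where
    "\<And>j. j \<le> Suc m \<Longrightarrow> \<sigma> j \<in> Sph m"
    "\<And>i j. \<lbrakk>i \<le> Suc m; j \<le> Suc m\<rbrakk> \<Longrightarrow> - 1 / (real m + 1) \<le> dot m (\<sigma> i) (\<sigma> j)"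
    "\<And>x. (\<Sum>j\<le>Suc m. dot m x (\<sigma> j)) = 0"
proof -
  define d where "d = real m + 1"
  define a where "a = sqrt ((d + 1) / d)"
  define c where "c = (sqrt (d + 1) - 1) / (d * sqrt d)"
  define \<sigma> where "\<sigma> j i = (if i \<le> m then (if j = Suc m then - 1 / sqrt d else (if i = j then a else 0) - c) else 0)"
    for j i :: nat
  have d: "d > 0" by (simp add: d_def)
  have sd: "sqrt d * sqrt d = d" "sqrt (d + 1) * sqrt (d + 1) = d + 1" "sqrt d > 0" using d by auto
  have a: "a = sqrt (d + 1) / sqrt d" by (simp add: a_def real_sqrt_divide)
  have adc: "a - d * c = 1 / sqrt d"
    using d sd by (simp add: a c_def field_simps)
  have aa: "a * a = (d + 1) / d" using d by (simp add: a_def)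
  have key: "d * (c * c) - 2 * (a * c) = - 1 / d"
  proof -
    have "(a - d * c) * (a - d * c) = 1 / d" using sd d unfolding adc by (simp add: field_simps)
    then have "a * a - 2 * d * (a * c) + d * d * (c * c) = 1 / d" by (simp add: algebra_simps)
    then have "d * (d * (c * c) - 2 * (a * c)) = 1 / d - a * a" by (simp add: algebra_simps)
    also have "\<dots> = - 1" using d by (simp add: aa field_simps)
    finally show ?thesis using d by (simp add: field_simps)
  qed
  have one: "(\<Sum>i\<le>m. 1::real) = d" by (simp add: d_def)
  have delta: "(\<Sum>i\<le>m. (if i = j then b else 0) * y i) = (if j \<le> m then b * y j else 0)" for j and b :: real and y
    by (simp add: if_distrib[where f = "\<lambda>x. x * _"] cong: if_cong)
  have inner: "dot m x (\<sigma> j) = (if j = Suc m then - (\<Sum>i\<le>m. x i) / sqrt d else a * x j - c * (\<Sum>i\<le>m. x i))"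
    if "j \<le> Suc m" for x j
  proof (cases "j = Suc m")
    case True
    then show ?thesis by (simp add: dot_def \<sigma>_def sum_divide_distrib sum_negf)
  next
    case False
    then have "j \<le> m" using that by simp
    have "dot m x (\<sigma> j) = (\<Sum>i\<le>m. (if i = j then a else 0) * x i - c * x i)"
      unfolding dot_def \<sigma>_def using False by (intro sum.cong) (auto simp: algebra_simps)
    also have "\<dots> = a * x j - c * (\<Sum>i\<le>m. x i)"
      using \<open>j \<le> m\<close> by (simp only: sum_subtractf delta sum_distrib_left if_True)
    finally show ?thesis using False by simp
  qed
  have total: "(\<Sum>i\<le>m. \<sigma> j i) = (if j = Suc m then - d / sqrt d else a - d * c)" if "j \<le> Suc m" for j
  proof (cases "j = Suc m")
    case True
    then show ?thesis using one by (simp add: \<sigma>_def)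
  next
    case False
    then have "j \<le> m" using that by simp
    have "(\<Sum>i\<le>m. \<sigma> j i) = (\<Sum>i\<le>m. (if i = j then a else 0) * 1 - c * 1)"
      unfolding \<sigma>_def using False by (intro sum.cong) auto
    also have "\<dots> = a * 1 - c * (\<Sum>i\<le>m. 1)"
      using \<open>j \<le> m\<close> delta[of j a "\<lambda>_. 1"] by (simp only: sum_subtractf sum_distrib_left if_True)
    finally show ?thesis using False one by simp
  qed
  have val: "dot m (\<sigma> i) (\<sigma> j) = (if i = j then 1 else - 1 / d)" if "i \<le> Suc m" "j \<le> Suc m" for i j
  proof -
    consider "i = Suc m" "j = Suc m" | "i \<noteq> Suc m" "j = Suc m" | "i = Suc m" "j \<noteq> Suc m"
      | "i \<noteq> Suc m" "j \<noteq> Suc m" by blast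
    then show ?thesis
    proof cases
      case 1 then show ?thesis using d sd unfolding inner[OF that(2)] total[OF that(1)] by (simp add: field_simps)
    next
      case 2
      then have "dot m (\<sigma> i) (\<sigma> j) = - (a - d * c) / sqrt d"
        unfolding inner[OF that(2)] total[OF that(1)] by simp
      also have "\<dots> = - 1 / d" unfolding adc using sd d by (simp add: field_simps)
      finally show ?thesis using 2 by simp
    next
      case 3
      then have "j \<le> m" using that by simp
      have "dot m (\<sigma> i) (\<sigma> j) = - (a - d * c) / sqrt d"
        unfolding inner[OF that(2)] total[OF that(1)] using 3 \<open>j \<le> m\<close> d sd by (simp add: \<sigma>_def field_simps)
      also have "\<dots> = - 1 / d" unfolding adc using sd d by (simp add: field_simps)
      finally show ?thesis using 3 by simp
    next
      case 4
      then have ij: "i \<le> m" "j \<le> m" using that by auto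
      have "dot m (\<sigma> i) (\<sigma> j) = a * ((if j = i then a else 0) - c) - c * (a - d * c)"
        unfolding inner[OF that(2)] total[OF that(1)] using 4 ij by (simp add: \<sigma>_def)
      also have "\<dots> = (if i = j then a * a else 0) + (d * (c * c) - 2 * (a * c))"
        by (simp add: algebra_simps)
      also have "\<dots> = (if i = j then 1 else - 1 / d)"
        unfolding key aa using d by (simp add: field_simps)
      finally show ?thesis .
    qed
  qed
  show thesis
  proof (rule that[of \<sigma>])
    show "\<sigma> j \<in> Sph m" if "j \<le> Suc m" for j
      using val[OF that that] by (simp add: Sph_iff \<sigma>_def)
    show "- 1 / (real m + 1) \<le> dot m (\<sigma> i) (\<sigma> j)" if "i \<le> Suc m" "j \<le> Suc m" for i j
    proof -
      have "- 1 / d \<le> 1" using d by (simp add: field_simps)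
      then show ?thesis using val[OF that] by (simp add: d_def)
    qed
    show "(\<Sum>j\<le>Suc m. dot m x (\<sigma> j)) = 0" for x
    proof -
      let ?S = "\<Sum>i\<le>m. x i"
      have "(\<Sum>j\<le>m. dot m x (\<sigma> j)) = (\<Sum>j\<le>m. a * x j - c * ?S)"
        by (rule sum.cong) (auto simp: inner)
      also have "\<dots> = a * ?S - (\<Sum>j\<le>m. c * ?S)"
        by (simp only: sum_subtractf sum_distrib_left)
      also have "(\<Sum>j\<le>m. c * ?S) = d * (c * ?S)" by (simp add: d_def)
      also have "a * ?S - d * (c * ?S) = (a - d * c) * ?S" by (simp add: left_diff_distrib mult.assoc)
      finally have "(\<Sum>j\<le>m. dot m x (\<sigma> j)) = ?S / sqrt d" by (simp add: adc)
      moreover have "dot m x (\<sigma> (Suc m)) = - ?S / sqrt d" by (simp add: inner)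
      ultimately show ?thesis by simp
    qed
  qed
qed

text \<open>
  The hypotheses give \<open>|x - v|^2 \<le> 2 - 2 \<langle>x, v\<rangle> \<le> \<eta>^2\<close>; then Cauchy-Schwarz applies.
\<close>

lemma dot_near:
  assumes "dot m x x \<le> 1" "v \<in> Sph m" "u \<in> Sph m" "1 - \<eta>\<^sup>2 / 2 < dot m x v" "0 < \<eta>"
  shows "\<bar>dot m x u - dot m v u\<bar> \<le> \<eta>"
proof -
  have "(dot m x u - dot m v u)\<^sup>2 \<le> dot m (\<lambda>i. x i - v i) (\<lambda>i. x i - v i) * dot m u u"
    using dot_Cauchy_Schwarz[of m "\<lambda>i. x i - v i" u] by (simp add: dot_diff)
  also have "\<dots> = dot m x x - 2 * dot m x v + 1"
    using assms(2,3) by (simp add: dot_diff Sph_iff dot_commute[of m v x])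
  also have "\<dots> \<le> \<eta>\<^sup>2" using assms(1,4) by (simp add: field_simps)
  finally show ?thesis using assms(5) abs_le_square_iff[of "dot m x u - dot m v u" \<eta>] by simp
qed

text \<open>
  Near the equator of \<open>nsphere (Suc m)\<close> the weights of a fine net describe the inclusion of the
  sphere. Towards the north pole, where \<open>x (Suc m) > 0\<close>, the vertices \<open>\<sigma> j\<close> of an
  inscribed regular simplex take over, which span a simplex of the complex at exactly this scale.
  At a given point only those with inner product above \<open>- \<eta>\<close> are used, so that they are also
  within this scale of the net points near \<open>x\<close>; some of them is always available, because the
  vertices sum to zero. At the south pole the antipodal simplex is used.
\<close>

lemma coind_VR_sphere_simplex:
  "enat (Suc m) \<le> coind (VR_sphere m (arccos (- 1 / (real m + 1)))) (realization_map antipode)"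
proof -
  define \<eta> where "\<eta> = 1 / (2 * (real m + 1))"
  have \<eta>: "0 < \<eta>" "\<eta> \<le> 1 / 2" "- 1 / (real m + 1) = - (2 * \<eta>)" by (auto simp: \<eta>_def field_simps)
  have "\<eta>\<^sup>2 \<le> (1/2)\<^sup>2" using \<eta> by (intro power_mono) auto
  then have \<eta>2: "\<eta>\<^sup>2 \<le> 1/4" by (simp add: power2_eq_square)
  define r where "r = arccos (- (2 * \<eta>))"
  have r: "0 \<le> r" "r \<le> pi" "cos r = - (2 * \<eta>)"
    using \<eta> by (auto simp: r_def arccos_lbound arccos_ubound)
  obtain V where V: "finite V" "V \<subseteq> Sph m" "\<And>x. x \<in> Sph m \<Longrightarrow> \<exists>v\<in>V. 1 - \<eta>\<^sup>2 / 2 < dot m x v"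
    using finite_net[of "\<eta>\<^sup>2 / 2" m] \<eta>(1) by auto
  obtain \<sigma> :: "nat \<Rightarrow> nat \<Rightarrow> real" where
    \<sigma>: "\<And>j. j \<le> Suc m \<Longrightarrow> \<sigma> j \<in> Sph m"
    and \<sigma>_dot: "\<And>i j. \<lbrakk>i \<le> Suc m; j \<le> Suc m\<rbrakk> \<Longrightarrow> - (2 * \<eta>) \<le> dot m (\<sigma> i) (\<sigma> j)"
    and \<sigma>_sum: "\<And>x. (\<Sum>j\<le>Suc m. dot m x (\<sigma> j)) = 0"
    using regular_simplex[of m] unfolding \<eta>(3) by metis
  define I :: "((nat \<Rightarrow> real) + nat) set" where "I = Inl ` V \<union> Inr ` {..Suc m}"
  define q where "q = case_sum (\<lambda>v. v) \<sigma>"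
  define g where "g = case_sum (\<lambda>v x. max 0 (dot m x v - (1 - \<eta>\<^sup>2 / 2)))
    (\<lambda>j x. max 0 (min (x (Suc m)) (dot m x (\<sigma> j) + \<eta>)))"
  have gl: "0 < g (Inl v) x \<longleftrightarrow> 1 - \<eta>\<^sup>2 / 2 < dot m x v" for v x by (auto simp: g_def)
  have gr: "0 < g (Inr j) x \<longleftrightarrow> 0 < x (Suc m) \<and> - \<eta> < dot m x (\<sigma> j)" for j x by (auto simp: g_def)
  have shrink: "dot m x x \<le> 1" if "x \<in> Sph (Suc m)" for x
    using that by (simp add: Sph_iff dot_Suc) (metis add_le_cancel_left add.commute le_add_same_cancel1 zero_le_square)
  have near: "\<bar>dot m x u - dot m v u\<bar> \<le> \<eta>"
    if "x \<in> Sph (Suc m)" "v \<in> V" "u \<in> Sph m" "1 - \<eta>\<^sup>2 / 2 < dot m x v" for x u v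
    using dot_near[OF shrink[OF that(1)] _ that(3,4) \<eta>(1)] that(2) V(2) by auto
  have anti: "antipode x (Suc m) = - x (Suc m)" for x by (simp add: antipode_def)
  have "enat (Suc m) \<le> coind (VR_sphere m r) (realization_map antipode)"
  proof (rule coind_VR_sphere_ge[OF r(1,2), of I q _ _ g])
    show "finite I" using V(1) by (simp add: I_def)
    show "q i \<in> Sph m" if "i \<in> I" for i
      using that V(2) \<sigma> by (auto simp: I_def q_def)
    show "continuous_on (Sph (Suc m)) (g i)" if "i \<in> I" for i
      using that unfolding I_def g_def
      by (auto intro!: continuous_on_max continuous_on_min continuous_on_diff continuous_on_add continuous_on_const
          continuous_on_dot continuous_on_id continuous_on_coordinate)
    show "0 \<le> g i x" if "i \<in> I" for i x
      using that by (auto simp: I_def g_def)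
    show "\<exists>i\<in>I. 0 < g i x \<or> 0 < g i (antipode x)" if x: "x \<in> Sph (Suc m)" for x
    proof -
      have up: "\<exists>i\<in>I. 0 < g i y" if y: "y (Suc m) > 0" for y
      proof -
        have "\<exists>j\<le>Suc m. 0 \<le> dot m y (\<sigma> j)"
        proof (rule ccontr)
          assume "\<not> ?thesis"
          then have "dot m y (\<sigma> j) < 0" if "j \<le> Suc m" for j using that by (meson not_le)
          then have "(\<Sum>j\<le>Suc m. dot m y (\<sigma> j)) < (\<Sum>j\<le>Suc m. 0)"
            by (intro sum_strict_mono) auto
          then show False using \<sigma>_sum[of y] by simp
        qed
        then obtain j where "j \<le> Suc m" "0 \<le> dot m y (\<sigma> j)" by blast
        then show ?thesis using y \<eta>(1) by (intro bexI[of _ "Inr j"]) (auto simp: gr I_def)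
      qed
      consider "x (Suc m) > 0" | "antipode x (Suc m) > 0" | "x (Suc m) = 0"
        unfolding anti by linarith
      then show ?thesis
      proof cases
        case 3
        then have "x \<in> Sph m" using topspace_nsphere_minus1[OF x] by simp
        then obtain v where "v \<in> V" "1 - \<eta>\<^sup>2 / 2 < dot m x v" using V(3) by blast
        then show ?thesis by (intro bexI[of _ "Inl v"]) (auto simp: gl I_def)
      qed (use up in blast)+
    qed
    show "cos r \<le> dot m (q i) (q j)"
      if ij: "i \<in> I" "j \<in> I" and x: "x \<in> Sph (Suc m)" and "0 < g i x" "0 < g j x" for i j x
    proof -
      have 1: "- (2 * \<eta>) \<le> dot m v u" if "v \<in> V" "u \<in> Sph m" "1 - \<eta>\<^sup>2 / 2 < dot m x v" "- \<eta> < dot m x u" for v u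
        using near[OF x that(1-3)] that(4) by linarith
      have c1: "- (2 * \<eta>) \<le> dot m u v" if "v \<in> V" "u \<in> Sph m" "1 - \<eta>\<^sup>2 / 2 < dot m x v" "- \<eta> < dot m x u" for v u
        using 1[OF that] by (simp add: dot_commute[of m u v])
      have 2: "- \<eta> < dot m x v" if "1 - \<eta>\<^sup>2 / 2 < dot m x v" for v
        using that \<eta>2 \<eta>(1) by linarith
      show ?thesis
        using that 1 c1 2 V(2) \<sigma> \<sigma>_dot unfolding r(3) I_def
        by (auto simp: q_def gl gr subset_iff)
    qed
    show "dot m (q i) (q j) \<le> - cos r"
      if ij: "i \<in> I" "j \<in> I" and x: "x \<in> Sph (Suc m)" and "0 < g i x" "0 < g j (antipode x)" for i j x
    proof -
      have x': "antipode x \<in> Sph (Suc m)" using x by (simp add: antipode_in_Sph)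
      have 1: "dot m v u \<le> 2 * \<eta>" if "v \<in> V" "u \<in> Sph m" "1 - \<eta>\<^sup>2 / 2 < dot m x v" "dot m x u < \<eta>" for v u
        using near[OF x that(1-3)] that(4) by linarith
      have 2: "dot m v u \<le> 2 * \<eta>" if "v \<in> V" "u \<in> Sph m" "1 - \<eta>\<^sup>2 / 2 < - dot m x v" "- \<eta> < dot m x u" for v u
        using near[OF x' that(1,2)] that(3,4) by (simp add: dot_antipode)
      have c1: "dot m u v \<le> 2 * \<eta>" if "v \<in> V" "u \<in> Sph m" "1 - \<eta>\<^sup>2 / 2 < dot m x v" "dot m x u < \<eta>" for v u
        using 1[OF that] by (simp add: dot_commute[of m u v])
      have c2: "dot m u v \<le> 2 * \<eta>" if "v \<in> V" "u \<in> Sph m" "1 - \<eta>\<^sup>2 / 2 < - dot m x v" "- \<eta> < dot m x u" for v u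
        using 2[OF that] by (simp add: dot_commute[of m u v])
      have 3: "dot m x v < \<eta>" if "1 - \<eta>\<^sup>2 / 2 < - dot m x v" for v
        using that \<eta>2 \<eta>(1) by linarith
      show ?thesis
        using that 1 c1 2 c2 3 V(2) \<sigma> unfolding r(3) I_def
        by (auto simp: q_def gl gr anti dot_antipode subset_iff)
    qed
  qed
  then show ?thesis by (simp only: r_def \<eta>(3))
qed

section \<open>Almost orthogonal vectors\<close>

text \<open>
  The moment generating function of a random sign is at most that of a standard Gaussian. With \<open>tanh y \<le> y\<close>,
  the function \<open>y^2 / 2 - ln (cosh y)\<close> is nondecreasing on the positive axis.
\<close>

lemma exp_symmetric_le:
  fixes l :: real
  shows "exp l + exp (- l) \<le> 2 * exp (l\<^sup>2 / 2)"
proof -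
  have *: "cosh x \<le> exp (x\<^sup>2 / 2)" if x: "0 \<le> x" for x :: real
  proof -
    have sinh_le: "sinh y \<le> y * cosh y" if "0 \<le> y" for y :: real
    proof -
      have "(\<lambda>y. y * cosh y - sinh y) 0 \<le> (\<lambda>y. y * cosh y - sinh y) y"
      proof (rule DERIV_nonneg_imp_nondecreasing[OF that])
        fix z :: real assume "0 \<le> z"
        then show "\<exists>D. ((\<lambda>y. y * cosh y - sinh y) has_real_derivative D) (at z) \<and> 0 \<le> D"
          by (intro exI[of _ "z * sinh z"] conjI) (auto intro!: derivative_eq_intros)
      qed
      then show ?thesis by simp
    qed
    have "(\<lambda>y. y\<^sup>2 / 2 - ln (cosh y)) 0 \<le> (\<lambda>y. y\<^sup>2 / 2 - ln (cosh y)) x"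
    proof (rule DERIV_nonneg_imp_nondecreasing[OF x])
      fix z :: real assume z: "0 \<le> z"
      have "cosh z > 0" by simp
      then have "0 \<le> z - sinh z / cosh z" using sinh_le[OF z] by (simp add: field_simps)
      moreover have "((\<lambda>y. y\<^sup>2 / 2 - ln (cosh y)) has_real_derivative (z - sinh z / cosh z)) (at z)"
        by (auto intro!: derivative_eq_intros simp: field_simps)
      ultimately show "\<exists>D. ((\<lambda>y. y\<^sup>2 / 2 - ln (cosh y)) has_real_derivative D) (at z) \<and> 0 \<le> D"
        by blast
    qed
    then have "ln (cosh x) \<le> x\<^sup>2 / 2" by simp
    then show ?thesis using exp_le_cancel_iff[of "ln (cosh x)" "x\<^sup>2 / 2"] by simp
  qed
  have "cosh l \<le> exp (l\<^sup>2 / 2)"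
    using *[of "\<bar>l\<bar>"] by (cases "0 \<le> l") auto
  then show ?thesis by (simp add: cosh_def)
qed

abbreviation signs :: "nat \<Rightarrow> (nat \<Rightarrow> real) set" where
  "signs m \<equiv> PiE {..m} (\<lambda>_. {-1, 1})"

lemma card_signs: "card (signs m) = 2 ^ Suc m"
proof -
  have c: "card {-1, 1 :: real} = 2" by simp
  have "card (signs m) = (\<Prod>i\<le>m. card {-1, 1 :: real})" by (rule card_PiE) simp
  then show ?thesis by (simp only: c prod_constant card_atMost)
qed

text \<open>
  The Chernoff bound for sums of independent signs, as a count. The exponent \<open>\<tau>\<close> in the
  moment generating function minimizes the Gaussian bound.
\<close>

lemma sign_tail_one_sided:
  assumes t: "\<And>i. i \<le> m \<Longrightarrow> t i = 1 \<or> t i = -1" and \<tau>: "0 \<le> \<tau>"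
  shows "real (card {s \<in> signs m. \<tau> * (real m + 1) \<le> dot m s t}) \<le> 2 ^ Suc m * exp (- ((real m + 1) * \<tau>\<^sup>2 / 2))"
proof -
  let ?B = "{s \<in> signs m. \<tau> * (real m + 1) \<le> dot m s t}"
  have fin: "finite (signs m)" by (intro finite_PiE) auto
  have "real (card ?B) * exp (\<tau> * (\<tau> * (real m + 1))) = (\<Sum>s\<in>?B. exp (\<tau> * (\<tau> * (real m + 1))))"
    by simp
  also have "\<dots> \<le> (\<Sum>s\<in>?B. exp (\<tau> * dot m s t))"
    using \<tau> by (intro sum_mono) (auto intro!: mult_left_mono)
  also have "\<dots> \<le> (\<Sum>s\<in>signs m. exp (\<tau> * dot m s t))"
    using fin by (intro sum_mono2) auto
  also have "\<dots> = (\<Sum>s\<in>signs m. \<Prod>i\<le>m. exp (\<tau> * (s i * t i)))"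
    by (simp add: dot_def sum_distrib_left exp_sum)
  also have "\<dots> = (\<Prod>i\<le>m. \<Sum>y\<in>{-1, 1}. exp (\<tau> * (y * t i)))"
    by (subst prod_sum_PiE) auto
  also have "\<dots> = (\<Prod>i\<le>m. exp \<tau> + exp (- \<tau>))"
  proof (rule prod.cong[OF refl])
    fix i assume "i \<in> {..m}"
    then show "(\<Sum>y\<in>{-1, 1}. exp (\<tau> * (y * t i))) = exp \<tau> + exp (- \<tau>)"
      using t[of i] by auto
  qed
  also have "\<dots> \<le> (\<Prod>i\<le>m. 2 * exp (\<tau>\<^sup>2 / 2))"
    by (intro prod_mono conjI exp_symmetric_le add_nonneg_nonneg) auto
  also have "\<dots> = 2 ^ Suc m * exp ((real m + 1) * \<tau>\<^sup>2 / 2)"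
    by (simp add: power_mult_distrib exp_of_nat_mult[symmetric] algebra_simps del: power_Suc)
  finally have "real (card ?B) * exp (\<tau> * (\<tau> * (real m + 1))) \<le> 2 ^ Suc m * exp ((real m + 1) * \<tau>\<^sup>2 / 2)" .
  then have "real (card ?B) * exp (\<tau> * (\<tau> * (real m + 1))) * exp (- (\<tau> * (\<tau> * (real m + 1))))
    \<le> 2 ^ Suc m * exp ((real m + 1) * \<tau>\<^sup>2 / 2) * exp (- (\<tau> * (\<tau> * (real m + 1))))"
    by (rule mult_right_mono) simp
  also have "\<dots> = 2 ^ Suc m * exp ((real m + 1) * \<tau>\<^sup>2 / 2 + - (\<tau> * (\<tau> * (real m + 1))))"
    by (simp only: exp_add mult.assoc)
  also have "(real m + 1) * \<tau>\<^sup>2 / 2 + - (\<tau> * (\<tau> * (real m + 1))) = - ((real m + 1) * \<tau>\<^sup>2 / 2)"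
    by (simp add: power2_eq_square field_simps)
  finally show ?thesis by (simp add: mult.assoc exp_minus)
qed

lemma sign_tail:
  assumes t: "t \<in> signs m" and \<tau>: "0 \<le> \<tau>"
  shows "real (card {s \<in> signs m. \<tau> * (real m + 1) \<le> \<bar>dot m s t\<bar>})
    \<le> 2 * (2 ^ Suc m * exp (- ((real m + 1) * \<tau>\<^sup>2 / 2)))"
proof -
  let ?b = "2 ^ Suc m * exp (- ((real m + 1) * \<tau>\<^sup>2 / 2))"
  have ti: "t i = 1 \<or> t i = -1" if "i \<le> m" for i using PiE_mem[OF t, of i] that by auto
  have nt: "- t i = 1 \<or> - t i = -1" if "i \<le> m" for i using ti[OF that] by auto
  have "{s \<in> signs m. \<tau> * (real m + 1) \<le> \<bar>dot m s t\<bar>} =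
      {s \<in> signs m. \<tau> * (real m + 1) \<le> dot m s t} \<union> {s \<in> signs m. \<tau> * (real m + 1) \<le> dot m s (\<lambda>i. - t i)}"
    by (auto simp: dot_minus abs_if)
  then have "real (card {s \<in> signs m. \<tau> * (real m + 1) \<le> \<bar>dot m s t\<bar>})
      \<le> real (card {s \<in> signs m. \<tau> * (real m + 1) \<le> dot m s t} + card {s \<in> signs m. \<tau> * (real m + 1) \<le> dot m s (\<lambda>i. - t i)})"
    by (simp only: card_Un_le of_nat_le_iff)
  also have "\<dots> \<le> ?b + ?b"
    unfolding of_nat_add
    by (rule add_mono[OF sign_tail_one_sided[OF ti \<tau>] sign_tail_one_sided[OF nt \<tau>]])
  finally show ?thesis by simp
qed

text \<open>
  Each chosen element excludes at most \<open>b\<close> elements, so a further choice is possible as long as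
  the excluded ones do not exhaust \<open>P\<close>.
\<close>

lemma greedy_choice:
  fixes b :: real
  assumes fin: "finite P" and b: "0 \<le> b" "\<And>t. t \<in> P \<Longrightarrow> real (card {s \<in> P. R s t}) \<le> b"
    and n: "real n * b < real (card P)"
  shows "\<exists>p. \<forall>i\<le>n. p i \<in> P \<and> (\<forall>j<i. \<not> R (p i) (p j))"
proof -
  have "\<exists>p. \<forall>i\<le>r. p i \<in> P \<and> (\<forall>j<i. \<not> R (p i) (p j))" if "r \<le> n" for r
    using that
  proof (induction r)
    case 0
    have "0 < real (card P)" using n b(1) by (smt (verit) mult_nonneg_nonneg of_nat_0_le_iff)
    then obtain s where "s \<in> P" by (metis card.empty ex_in_conv less_irrefl of_nat_0)
    then show ?case by (intro exI[of _ "\<lambda>_. s"]) simp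
  next
    case (Suc r)
    then obtain p where p: "\<And>i. i \<le> r \<Longrightarrow> p i \<in> P \<and> (\<forall>j<i. \<not> R (p i) (p j))" by auto
    let ?bad = "\<Union>j\<le>r. {s \<in> P. R s (p j)}"
    have "real (card ?bad) \<le> real (\<Sum>j\<le>r. card {s \<in> P. R s (p j)})"
      by (simp only: of_nat_le_iff card_UN_le finite_atMost)
    also have "\<dots> \<le> (\<Sum>j\<le>r. b)" unfolding of_nat_sum using p b(2) by (intro sum_mono) auto
    also have "\<dots> = real (Suc r) * b" by simp
    also have "\<dots> \<le> real n * b" using Suc.prems b(1) by (intro mult_right_mono) auto
    finally have "card ?bad < card P" using n by simp
    moreover have "finite ?bad" using fin by auto
    ultimately have "\<not> P \<subseteq> ?bad" using card_mono leD by blast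
    then obtain s where s: "s \<in> P" "\<And>j. j \<le> r \<Longrightarrow> \<not> R s (p j)" by auto
    show ?case
      by (rule exI[of _ "p(Suc r := s)"]) (use p s in \<open>auto simp: le_Suc_eq less_Suc_eq_le\<close>)
  qed
  then show ?thesis by blast
qed

text \<open>
  The boundary of the cross-polytope on \<open>\<plusminus> u i\<close>: a vertex and its antipode are never active
  together, and any two other vertices have inner product at least \<open>- \<tau>\<close>.
\<close>

lemma coind_VR_sphere_cross_polytope:
  assumes u: "\<And>i. i \<le> n \<Longrightarrow> u i \<in> Sph m"
    and orth: "\<And>i j. \<lbrakk>i \<le> n; j \<le> n; i \<noteq> j\<rbrakk> \<Longrightarrow> \<bar>dot m (u i) (u j)\<bar> \<le> \<tau>"
    and \<tau>: "0 \<le> \<tau>" "\<tau> \<le> 1"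
  shows "enat n \<le> coind (VR_sphere m (pi / 2 + arcsin \<tau>)) (realization_map antipode)"
proof -
  let ?r = "pi / 2 + arcsin \<tau>"
  have as: "0 \<le> arcsin \<tau>" "arcsin \<tau> \<le> pi / 2"
    using arcsin_le_arcsin[of 0 \<tau>] arcsin_bounded[of \<tau>] \<tau> by auto
  have cosr: "cos ?r = - \<tau>" using \<tau> by (simp add: cos_add)
  show ?thesis
  proof (rule coind_VR_sphere_ge[of _ "{..n}" u _ _ "\<lambda>i x. max 0 (x i)"])
    show "0 \<le> ?r" "?r \<le> pi" using as by auto
    show "continuous_on (Sph n) (\<lambda>x. max 0 (x i))" for i
      by (intro continuous_on_max continuous_on_const continuous_on_coordinate)
    show "\<exists>i\<in>{..n}. 0 < max 0 (x i) \<or> 0 < max 0 (antipode x i)" if "x \<in> Sph n" for x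
    proof -
      have "\<exists>i\<le>n. x i \<noteq> 0" using that dot_self_eq_0[of n x] by (auto simp: Sph_iff)
      then obtain i where "i \<le> n" "x i \<noteq> 0" by blast
      then show ?thesis by (intro bexI[of _ i]) (auto simp: antipode_def)
    qed
    show "cos ?r \<le> dot m (u i) (u j)" if "i \<in> {..n}" "j \<in> {..n}" for i j
    proof (cases "i = j")
      case True
      then show ?thesis unfolding cosr using u[of j] that \<tau> by (simp add: Sph_iff)
    next
      case False
      then show ?thesis unfolding cosr using orth[of i j] that by auto
    qed
    show "dot m (u i) (u j) \<le> - cos ?r"
      if "i \<in> {..n}" "j \<in> {..n}" "0 < max 0 (x i)" "0 < max 0 (antipode x j)" for i j x
    proof -
      have "i \<noteq> j" using that by (auto simp: antipode_def)
      then show ?thesis unfolding cosr using orth[of i j] that by auto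
    qed
  qed (use u in auto)
qed

text \<open>
  Greedy choice among the normalized sign vectors. The value of \<open>tau m n\<close> is such that each vector
  excludes a proportion \<open>2 / (e (n + 1)^2)\<close> of them, and \<open>n\<close> such proportions add up to
  less than 1.
\<close>

lemma almost_orthogonal_vectors:
  obtains u where "\<And>i. i \<le> n \<Longrightarrow> u i \<in> Sph m"
    "\<And>i j. \<lbrakk>i \<le> n; j \<le> n; i \<noteq> j\<rbrakk> \<Longrightarrow> \<bar>dot m (u i) (u j)\<bar> \<le> tau m n"
proof -
  define d where "d = real m + 1"
  define \<tau> where "\<tau> = tau m n"
  have d: "d > 0" by (simp add: d_def)
  have ln0: "0 \<le> ln (real n + 1)" by simp
  have \<tau>: "0 \<le> \<tau>" "d * \<tau>\<^sup>2 = 4 * ln (real n + 1) + 2"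
    using ln0 by (auto simp: \<tau>_def tau_def d_def)
  define b where "b = 2 * (2 ^ Suc m * exp (- (d * \<tau>\<^sup>2 / 2)))"
  have "exp (- (d * \<tau>\<^sup>2 / 2)) = exp (- 1 - 2 * ln (real n + 1))" by (simp add: \<tau>(2) field_simps)
  also have "\<dots> = exp (- 1) / (exp (ln (real n + 1)))\<^sup>2"
    by (simp only: exp_diff exp_double)
  also have "\<dots> = exp (- 1) / (real n + 1)\<^sup>2" by simp
  finally have e: "exp (- (d * \<tau>\<^sup>2 / 2)) = exp (- 1) / (real n + 1)\<^sup>2" .
  have "2 \<le> exp (1::real)" using exp_ge_add_one_self[of 1] by simp
  then have e1: "2 * exp (- 1) \<le> (1::real)" by (simp add: exp_minus field_simps)
  have "real n * (2 * exp (- 1)) \<le> real n * 1" by (rule mult_left_mono[OF e1]) simp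
  also have "\<dots> < (real n + 1)\<^sup>2" by (simp add: power2_eq_square algebra_simps add_pos_nonneg)
  finally have "real n * (2 * exp (- 1)) / (real n + 1)\<^sup>2 < 1" by simp
  then have "2 ^ Suc m * (real n * (2 * exp (- 1)) / (real n + 1)\<^sup>2) < 2 ^ Suc m * 1"
    by (intro mult_strict_left_mono) auto
  then have n: "real n * b < real (card (signs m))"
    unfolding card_signs b_def e by (simp add: mult_ac)
  have "\<exists>p. \<forall>i\<le>n. p i \<in> signs m \<and> (\<forall>j<i. \<not> \<tau> * d \<le> \<bar>dot m (p i) (p j)\<bar>)"
  proof (rule greedy_choice[OF _ _ _ n])
    show "finite (signs m)" by (intro finite_PiE) auto
    show "0 \<le> b" by (simp add: b_def)
    show "real (card {s \<in> signs m. \<tau> * d \<le> \<bar>dot m s t\<bar>}) \<le> b" if "t \<in> signs m" for t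
      using sign_tail[OF that \<tau>(1)] by (simp add: b_def d_def)
  qed
  then obtain p where p: "\<And>i. i \<le> n \<Longrightarrow> p i \<in> signs m"
    and orth: "\<And>i j. \<lbrakk>i \<le> n; j < i\<rbrakk> \<Longrightarrow> \<bar>dot m (p i) (p j)\<bar> < \<tau> * d"
    by (auto simp: not_le)
  define u where "u i k = (if k \<le> m then p i k / sqrt d else 0)" for i k
  have udot: "dot m (u i) (u j) = dot m (p i) (p j) / d" for i j
  proof -
    have "dot m (u i) (u j) = (\<Sum>k\<le>m. (p i k * p j k) / d)"
      unfolding dot_def using d by (intro sum.cong) (auto simp: u_def)
    then show ?thesis by (simp add: dot_def sum_divide_distrib)
  qed
  have small: "\<bar>dot m (u i) (u j)\<bar> \<le> \<tau>" if "i \<le> n" "j < i" for i j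
    using orth[OF that] d by (simp add: udot abs_divide field_simps)
  show thesis
  proof (rule that[of u])
    show "u i \<in> Sph m" if "i \<le> n" for i
    proof -
      have "p i k = 1 \<or> p i k = -1" if "k \<le> m" for k
        using PiE_mem[OF p[OF \<open>i \<le> n\<close>], of k] that by auto
      then have "p i k * p i k = 1" if "k \<le> m" for k using that by fastforce
      then have "dot m (p i) (p i) = d" by (simp add: dot_def d_def)
      then show ?thesis using d udot[of i i] by (simp add: Sph_iff u_def)
    qed
    show "\<bar>dot m (u i) (u j)\<bar> \<le> tau m n" if "i \<le> n" "j \<le> n" "i \<noteq> j" for i j
      using small[of i j] small[of j i] that dot_commute[of m "u i" "u j"]
      unfolding \<tau>_def by (metis linorder_neqE_nat)
  qed
qed

lemma tau_nonneg: "0 \<le> tau m n"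
  unfolding tau_def by (intro real_sqrt_ge_zero divide_nonneg_nonneg add_nonneg_nonneg) auto

text \<open>
  If \<open>tau m n > 1\<close>, the almost orthogonality holds trivially with bound 1, and the scale is
  \<open>\<pi>\<close>, the diameter of the sphere.
\<close>

lemma coind_VR_sphere_tau:
  "enat n \<le> coind (VR_sphere m (pi / 2 + arcsin (min (tau m n) 1))) (realization_map antipode)"
proof -
  obtain u where u: "\<And>i. i \<le> n \<Longrightarrow> u i \<in> Sph m"
    "\<And>i j. \<lbrakk>i \<le> n; j \<le> n; i \<noteq> j\<rbrakk> \<Longrightarrow> \<bar>dot m (u i) (u j)\<bar> \<le> tau m n"
    using almost_orthogonal_vectors by metis
  show ?thesis
  proof (rule coind_VR_sphere_cross_polytope[of n u])
    show "\<bar>dot m (u i) (u j)\<bar> \<le> min (tau m n) 1" if "i \<le> n" "j \<le> n" "i \<noteq> j" for i j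
      using u(2)[OF that] abs_dot_le_1[OF u(1) u(1)] that by simp
  qed (use u(1) tau_nonneg in auto)
qed

section \<open>Bounds and limits of the thresholds\<close>

lemma coind_threshold_le:
  assumes "0 \<le> r" "enat n \<le> coind (VR_sphere m r) (realization_map antipode)"
  shows "coind_threshold m n \<le> r"
  unfolding coind_threshold_def using assms by (intro cInf_lower bdd_belowI[of _ 0]) auto

lemma radius_nonneg: "0 \<le> pi / 2 + arcsin (min (tau m n) 1)"
proof -
  have "arcsin 0 \<le> arcsin (min (tau m n) 1)"
    using tau_nonneg by (intro arcsin_le_arcsin) auto
  then show ?thesis using pi_ge_zero by (simp only: arcsin_0)
qed

lemma coind_threshold_set_nonempty:
  "{r. 0 \<le> r \<and> enat n \<le> coind (VR_sphere m r) (realization_map antipode)} \<noteq> {}"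
proof -
  have "pi / 2 + arcsin (min (tau m n) 1) \<in> {r. 0 \<le> r \<and> enat n \<le> coind (VR_sphere m r) (realization_map antipode)}"
    by (intro CollectI conjI radius_nonneg coind_VR_sphere_tau)
  then show ?thesis by (metis empty_iff)
qed

text \<open>
  The infimum is over a smaller set for larger \<open>n\<close>; that the set is nonempty matters because the
  infimum of the empty set of reals is an arbitrary value.
\<close>

lemma coind_threshold_mono:
  assumes "k \<le> n"
  shows "coind_threshold m k \<le> coind_threshold m n"
  unfolding coind_threshold_def
proof (rule cInf_superset_mono[OF coind_threshold_set_nonempty])
  show "bdd_below {r. 0 \<le> r \<and> enat k \<le> coind (VR_sphere m r) (realization_map antipode)}"
    by (rule bdd_belowI[of _ 0]) auto
  have "enat k \<le> enat n" using assms by simp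
  then show "{r. 0 \<le> r \<and> enat n \<le> coind (VR_sphere m r) (realization_map antipode)}
    \<subseteq> {r. 0 \<le> r \<and> enat k \<le> coind (VR_sphere m r) (realization_map antipode)}"
    using order_trans by blast
qed

lemma coind_threshold_Suc: "coind_threshold m (Suc m) = arccos (- 1 / (real m + 1))"
proof (rule antisym)
  have "0 \<le> arccos (- 1 / (real m + 1))" by (rule arccos_lbound) (auto simp: field_simps)
  then show "coind_threshold m (Suc m) \<le> arccos (- 1 / (real m + 1))"
    using coind_VR_sphere_simplex by (rule coind_threshold_le)
  show "arccos (- 1 / (real m + 1)) \<le> coind_threshold m (Suc m)"
    unfolding coind_threshold_def
  proof (rule cInf_greatest[OF coind_threshold_set_nonempty])
    fix r assume "r \<in> {r. 0 \<le> r \<and> enat (Suc m) \<le> coind (VR_sphere m r) (realization_map antipode)}"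
    then show "arccos (- 1 / (real m + 1)) \<le> r"
      using coind_VR_sphere_below[of r m] by (auto simp: not_less[symmetric])
  qed
qed

lemma coind_threshold_upper: "coind_threshold m n \<le> pi / 2 + arcsin (min (tau m n) 1)"
  by (rule coind_threshold_le[OF radius_nonneg coind_VR_sphere_tau])

lemma coind_threshold_lower:
  assumes "m < n"
  shows "arccos (- 1 / (real m + 1)) \<le> coind_threshold m n"
  using coind_threshold_mono[of "Suc m" n m] assms by (simp add: coind_threshold_Suc)

lemma coind_threshold_tendsto:
  fixes M N :: "nat \<Rightarrow> nat"
  assumes MN: "\<And>j. 1 \<le> M j" "\<And>j. M j < N j" and M: "filterlim M at_top sequentially"
    and small: "(\<lambda>j. ln (real (N j) + 1)) \<in> o(\<lambda>j. real (M j))"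
  shows "(\<lambda>j. coind_threshold (M j) (N j)) \<longlonglongrightarrow> pi / 2"
proof (rule tendsto_sandwich)
  have M_real: "filterlim (\<lambda>j. real (M j)) at_top sequentially"
    by (rule filterlim_compose[OF filterlim_real_sequentially M])
  have M1: "filterlim (\<lambda>j. real (M j) + 1) at_top sequentially"
    by (rule filterlim_at_top_mono[OF M_real]) simp
  have "(\<lambda>j. - 1 / (real (M j) + 1)) \<longlonglongrightarrow> 0"
    by (rule real_tendsto_divide_at_top[OF tendsto_const M1])
  then have "(\<lambda>j. arccos (- 1 / (real (M j) + 1))) \<longlonglongrightarrow> arccos 0"
    by (intro isCont_tendsto_compose[OF isCont_arccos]) auto
  then show "(\<lambda>j. arccos (- 1 / (real (M j) + 1))) \<longlonglongrightarrow> pi / 2" by simp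
  have lim: "(\<lambda>j. 4 * (ln (real (N j) + 1) / real (M j)) + 2 / real (M j)) \<longlonglongrightarrow> 4 * 0 + 0"
    by (intro tendsto_add tendsto_mult tendsto_const smalloD_tendsto[OF small]
        real_tendsto_divide_at_top[OF tendsto_const M_real])
  have "(\<lambda>j. (4 * ln (real (N j) + 1) + 2) / (real (M j) + 1)) \<longlonglongrightarrow> 0"
  proof (rule tendsto_sandwich[OF _ _ tendsto_const lim[simplified]])
    show "\<forall>\<^sub>F j in sequentially. 0 \<le> (4 * ln (real (N j) + 1) + 2) / (real (M j) + 1)"
      by (intro always_eventually allI divide_nonneg_nonneg add_nonneg_nonneg) auto
    show "\<forall>\<^sub>F j in sequentially. (4 * ln (real (N j) + 1) + 2) / (real (M j) + 1)
        \<le> 4 * ln (real (N j) + 1) / real (M j) + 2 / real (M j)"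
    proof (intro always_eventually allI)
      fix j
      have "(4 * ln (real (N j) + 1) + 2) / (real (M j) + 1) \<le> (4 * ln (real (N j) + 1) + 2) / real (M j)"
        using MN(1)[of j] by (intro divide_left_mono) (auto intro!: add_nonneg_nonneg mult_pos_pos)
      then show "(4 * ln (real (N j) + 1) + 2) / (real (M j) + 1)
          \<le> 4 * ln (real (N j) + 1) / real (M j) + 2 / real (M j)"
        by (simp add: add_divide_distrib)
    qed
  qed
  then have "(\<lambda>j. tau (M j) (N j)) \<longlonglongrightarrow> sqrt 0"
    unfolding tau_def by (rule tendsto_real_sqrt)
  then have "(\<lambda>j. min (tau (M j) (N j)) 1) \<longlonglongrightarrow> min 0 1"
    by (intro tendsto_min tendsto_const) simp
  then have "(\<lambda>j. arcsin (min (tau (M j) (N j)) 1)) \<longlonglongrightarrow> arcsin 0"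
    by (intro isCont_tendsto_compose[OF isCont_arcsin]) auto
  then have "(\<lambda>j. pi / 2 + arcsin (min (tau (M j) (N j)) 1)) \<longlonglongrightarrow> pi / 2 + 0"
    by (intro tendsto_add tendsto_const) simp
  then show "(\<lambda>j. pi / 2 + arcsin (min (tau (M j) (N j)) 1)) \<longlonglongrightarrow> pi / 2" by simp
qed (intro always_eventually allI coind_threshold_lower[OF MN(2)] coind_threshold_upper)+

text \<open>
  A convergent ratio bounds \<open>N\<close> linearly in \<open>M\<close>, so \<open>ln (N + 1)\<close> grows at most like
  \<open>ln M\<close>.
\<close>

lemma ln_smallo_of_linear:
  fixes M N :: "nat \<Rightarrow> nat"
  assumes M: "\<And>j. 1 \<le> M j" "filterlim M at_top sequentially"
    and lim: "(\<lambda>j. real (N j) / real (M j)) \<longlonglongrightarrow> l" and l: "0 \<le> l"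
  shows "(\<lambda>j. ln (real (N j) + 1)) \<in> o(\<lambda>j. real (M j))"
proof (rule smalloI_tendsto)
  have M_real: "filterlim (\<lambda>j. real (M j)) at_top sequentially"
    by (rule filterlim_compose[OF filterlim_real_sequentially M(2)])
  have "(\<lambda>j. ln (l + 2) / real (M j) + ln (real (M j)) / real (M j)) \<longlonglongrightarrow> 0 + 0"
    by (intro tendsto_add real_tendsto_divide_at_top[OF tendsto_const M_real]
        filterlim_compose[OF ln_x_over_x_tendsto_0 M_real])
  then have up: "(\<lambda>j. ln (l + 2) / real (M j) + ln (real (M j)) / real (M j)) \<longlonglongrightarrow> 0" by simp
  show "(\<lambda>j. ln (real (N j) + 1) / real (M j)) \<longlonglongrightarrow> 0"
  proof (rule tendsto_sandwich[OF _ _ tendsto_const up])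
    show "\<forall>\<^sub>F j in sequentially. 0 \<le> ln (real (N j) + 1) / real (M j)" by simp
    have "\<forall>\<^sub>F j in sequentially. real (N j) / real (M j) < l + 1"
      using lim by (rule order_tendstoD) simp
    then show "\<forall>\<^sub>F j in sequentially. ln (real (N j) + 1) / real (M j)
        \<le> ln (l + 2) / real (M j) + ln (real (M j)) / real (M j)"
    proof eventually_elim
      case (elim j)
      have m: "1 \<le> real (M j)" using M(1)[of j] by simp
      have "real (N j) < (l + 1) * real (M j)" using elim m by (simp add: field_simps)
      then have "real (N j) + 1 \<le> (l + 2) * real (M j)" using m by (simp add: algebra_simps)
      then have "ln (real (N j) + 1) \<le> ln ((l + 2) * real (M j))" using m l by (subst ln_le_cancel_iff) auto
      also have "\<dots> = ln (l + 2) + ln (real (M j))" using m l by (intro ln_mult_pos) auto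
      finally show ?case using m by (simp add: divide_right_mono flip: add_divide_distrib)
    qed
  qed
  show "\<forall>\<^sub>F j in sequentially. real (M j) \<noteq> 0"
    using M(1) by (intro always_eventually allI) (metis not_one_le_zero of_nat_eq_0_iff)
qed

theorem mainTheorem2:
  shows
    "(\<forall>m n. 1 \<le> m \<and> m < n \<longrightarrow>
        coind_threshold m n \<le> pi / 2 + arcsin (min (tau m n) 1)) \<and>
     (\<forall>m n. 1 \<le> m \<and> m < n \<longrightarrow>
        coind_threshold m (m + 1) = arccos (- 1 / (real m + 1)) \<and> coind_threshold m n \<ge> coind_threshold m (m + 1)) \<and>
     (\<forall>(M :: nat \<Rightarrow> nat) (N :: nat \<Rightarrow> nat).
        (\<forall>j. 1 \<le> M j \<and> M j < N j) \<and>
        filterlim M at_top sequentially \<and>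
        (\<lambda>j. ln (real (N j) + 1)) \<in> o(\<lambda>j. real (M j)) \<longrightarrow>
        (\<lambda>j. coind_threshold (M j) (N j)) \<longlonglongrightarrow> pi / 2) \<and>
     (\<forall>(M :: nat \<Rightarrow> nat) (N :: nat \<Rightarrow> nat) (l :: real).
        (\<forall>j. 1 \<le> M j \<and> M j < N j) \<and>
        filterlim M at_top sequentially \<and>
        1 < l \<and> (\<lambda>j. real (N j) / real (M j)) \<longlonglongrightarrow> l \<longrightarrow>
        (\<lambda>j. coind_threshold (M j) (N j)) \<longlonglongrightarrow> pi / 2)"
proof (intro conjI allI impI)
  fix m n :: nat assume "1 \<le> m \<and> m < n"
  then show "coind_threshold m (m + 1) \<le> coind_threshold m n"
    by (intro coind_threshold_mono) simp
  show "coind_threshold m n \<le> pi / 2 + arcsin (min (tau m n) 1)"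
    by (rule coind_threshold_upper)
  show "coind_threshold m (m + 1) = arccos (- 1 / (real m + 1))"
    using coind_threshold_Suc[of m] by simp
next
  fix M N :: "nat \<Rightarrow> nat"
  assume "(\<forall>j. 1 \<le> M j \<and> M j < N j) \<and> filterlim M at_top sequentially \<and>
    (\<lambda>j. ln (real (N j) + 1)) \<in> o(\<lambda>j. real (M j))"
  then show "(\<lambda>j. coind_threshold (M j) (N j)) \<longlonglongrightarrow> pi / 2"
    by (intro coind_threshold_tendsto) blast+
next
  fix M N :: "nat \<Rightarrow> nat" and l :: real
  assume *: "(\<forall>j. 1 \<le> M j \<and> M j < N j) \<and> filterlim M at_top sequentially \<and>
    1 < l \<and> (\<lambda>j. real (N j) / real (M j)) \<longlonglongrightarrow> l"
  then have "(\<lambda>j. ln (real (N j) + 1)) \<in> o(\<lambda>j. real (M j))"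
    by (intro ln_smallo_of_linear[of M N l]) auto
  with * show "(\<lambda>j. coind_threshold (M j) (N j)) \<longlonglongrightarrow> pi / 2"
    by (intro coind_threshold_tendsto) blast+
qed

end
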